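(* Let $\Omega\subset\mathbb{R}^{n+m}$ be a bounded Lipschitz domain, $s\in(0,1)$, $p\in(1,\infty)$. Let $u$ be a positive eigenfunction associated with $\lambda_1(s,p)$. If $\lambda>0$ is such that there exists a non-negative eigenfunction $v$ with eigenvalue $\lambda$, then $\lambda=\lambda_1(s,p)$ and there exists $k\in\mathbb{R}$ such that $v=ku$ a.e. in $\Omega$.
   Context: Points of $\mathbb{R}^{n+m}$ are $(x,y)$, $x\in\mathbb{R}^n$, $y\in\mathbb{R}^m$. $[u]^p_{\mathcal W^{s,p}(\mathbb{R}^{n+m})}=\int_{\mathbb{R}^{n+m}}\int_{\mathbb{R}^n}\frac{|u(x,y)-u(z,y)|^p}{|x-z|^{n+sp}}dz\,dx\,dy+\int_{\mathbb{R}^{n+m}}\int_{\mathbb{R}^m}\frac{|u(x,y)-u(x,w)|^p}{|y-w|^{m+sp}}dw\,dx\,dy$; $\widetilde{\mathcal W}^{s,p}(\Omega)$ is the set of $u\in L^p(\mathbb{R}^{n+m})$ with finite seminorm and $u\equiv0$ outside $\Omega$. With $(a)^{p-1}=|a|^{p-2}a$, $\mathcal H_{s,p}(u,v)=\int_{\mathbb{R}^{n+m}}\int_{\mathbb{R}^n}\frac{(u(x,y)-u(z,y))^{p-1}(v(x,y)-v(z,y))}{|x-z|^{n+sp}}dz\,dx\,dy+\int_{\mathbb{R}^{n+m}}\int_{\mathbb{R}^m}\frac{(u(x,y)-u(x,w))^{p-1}(v(x,y)-v(x,w))}{|y-w|^{m+sp}}dw\,dx\,dy$. A real $\lambda$ is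 an eigenvalue with eigenfunction $u\in\widetilde{\mathcal W}^{s,p}(\Omega)\setminus\{0\}$ if $\mathcal H_{s,p}(u,\varphi)=\lambda\int_\Omega(u)^{p-1}\varphi$ for all $\varphi\in\widetilde{\mathcal W}^{s,p}(\Omega)$. $\lambda_1(s,p)=\inf\{[u]^p_{\mathcal W^{s,p}(\mathbb{R}^{n+m})}/\|u\|^p_{L^p(\Omega)}:u\in\widetilde{\mathcal W}^{s,p}(\Omega),u\not\equiv0\}$ is the first eigenvalue. *)

theory Defs
  imports "HOL-Analysis.Analysis"
begin

text \<open>Points of R^(n+m) are pairs (x,y) with x :: 'a, y :: 'b (Euclidean spaces of
 dimensions n = DIM('a), m = DIM('b)); Lebesgue measure is lborel.\<close>

definition spow :: "real \<Rightarrow> real \<Rightarrow> real" where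
  "spow a q = sgn a * \<bar>a\<bar> powr q"

text \<open>Bounded Lipschitz domain: open, connected, bounded, and near every boundary point
 the domain is (after a rotation, encoded by a unit direction e) the region below the graph
 of a Lipschitz function defined on the hyperplane orthogonal to e.\<close>
definition lipschitz_domain :: "'c::euclidean_space set \<Rightarrow> bool" where
  "lipschitz_domain \<Omega> \<longleftrightarrow> open \<Omega> \<and> connected \<Omega> \<and> \<Omega> \<noteq> {} \<and>
     (\<forall>q\<in>frontier \<Omega>. \<exists>r>0. \<exists>e. norm e = 1 \<and> (\<exists>g L. L-lipschitz_on {w. w \<bullet> e = 0} g \<and>
        \<Omega> \<inter> ball q r = {z \<in> ball q r. z \<bullet> e < g (z - (z \<bullet> e) *\<^sub>R e)}))"

definition aniso_seminorm ::
  "real \<Rightarrow> real \<Rightarrow> ('a::euclidean_space \<times> 'b::euclidean_space \<Rightarrow> real) \<Rightarrow> ennreal" where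
  "aniso_seminorm s p u =
     (\<integral>\<^sup>+ w. \<integral>\<^sup>+ z. ennreal (\<bar>u (fst w, snd w) - u (z, snd w)\<bar> powr p /
                              norm (fst w - z) powr (real DIM('a) + s * p)) \<partial>lborel \<partial>lborel)
   + (\<integral>\<^sup>+ w. \<integral>\<^sup>+ z. ennreal (\<bar>u (fst w, snd w) - u (fst w, z)\<bar> powr p /
                              norm (snd w - z) powr (real DIM('b) + s * p)) \<partial>lborel \<partial>lborel)"

definition Wtilde ::
  "real \<Rightarrow> real \<Rightarrow> ('a::euclidean_space \<times> 'b::euclidean_space) set
     \<Rightarrow> ('a \<times> 'b \<Rightarrow> real) set" where
  "Wtilde s p \<Omega> = {u. u \<in> borel_measurable lborel \<and>
       integrable lborel (\<lambda>z. \<bar>u z\<bar> powr p) \<and>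
       aniso_seminorm s p u < \<infinity> \<and>
       (AE z in lborel. z \<notin> \<Omega> \<longrightarrow> u z = 0)}"

definition H_form ::
  "real \<Rightarrow> real \<Rightarrow> ('a::euclidean_space \<times> 'b::euclidean_space \<Rightarrow> real)
     \<Rightarrow> ('a \<times> 'b \<Rightarrow> real) \<Rightarrow> real" where
  "H_form s p u v =
     (\<integral> w. \<integral> z. spow (u (fst w, snd w) - u (z, snd w)) (p - 1) * (v (fst w, snd w) - v (z, snd w))
                 / norm (fst w - z) powr (real DIM('a) + s * p) \<partial>lborel \<partial>lborel)
   + (\<integral> w. \<integral> z. spow (u (fst w, snd w) - u (fst w, z)) (p - 1) * (v (fst w, snd w) - v (fst w, z))
                 / norm (snd w - z) powr (real DIM('b) + s * p) \<partial>lborel \<partial>lborel)"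

definition is_eigenpair ::
  "real \<Rightarrow> real \<Rightarrow> ('a::euclidean_space \<times> 'b::euclidean_space) set
     \<Rightarrow> real \<Rightarrow> ('a \<times> 'b \<Rightarrow> real) \<Rightarrow> bool" where
  "is_eigenpair s p \<Omega> lam u \<longleftrightarrow> u \<in> Wtilde s p \<Omega> \<and> \<not> (AE z in lborel. u z = 0) \<and>
     (\<forall>\<phi> \<in> Wtilde s p \<Omega>. H_form s p u \<phi> = lam * (\<integral>z\<in>\<Omega>. spow (u z) (p - 1) * \<phi> z \<partial>lborel))"

definition lambda1 ::
  "real \<Rightarrow> real \<Rightarrow> ('a::euclidean_space \<times> 'b::euclidean_space) set \<Rightarrow> real" where
  "lambda1 s p \<Omega> = Inf {enn2real (aniso_seminorm s p u) / (\<integral>z\<in>\<Omega>. \<bar>u z\<bar> powr p \<partial>lborel) | u.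
       u \<in> Wtilde s p \<Omega> \<and> \<not> (AE z in lborel. u z = 0)}"

end

(*
  Test the equation for v with phi_n = min(u,n)^p / (v + 1/n)^(p-1).  By the discrete Picone
  inequality the defect |U(x)-U(z)|^p - (v(x)-v(z))^(p-1) (phi_n(x)-phi_n(z)), U = min(u,n), is
  nonnegative, and its total integral is at most [u]^p - lam * int v^(p-1) phi_n.  Fatou's lemma
  is applied twice.  First, the defect blows up at pairs with v(x) = 0 < v(z), so the set {v > 0}
  is a.e. invariant along horizontal and vertical lines within the domain; since the domain is
  connected, v > 0 a.e. there, and no separate maximum principle is needed.  Secondly, the
  integrals now tend to (lambda_1 - lam) int u^p, which must therefore be zero, and the equality
  case of Picone makes v/u a.e. constant along lines, hence constant.
*)
theory Submission
  imports Defs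
begin

subsection \<open>The discrete Picone inequality\<close>

text \<open>The ideal test function u^p / v^(p-1) may have infinite energy and makes no sense where
  v vanishes. Capping u and shifting v turns it into a Lipschitz function of the pair (u, v) that
  vanishes with u, so it is admissible; and since the shift cancels in differences of v, the
  equation for v still produces a Picone expression exactly. The positivity of v has to come first:
  where v = 0 the product v^(p-1) phi_n is 0 for every n, so the limit of its integral is int u^p
  only once v > 0 is known. Until then lam > 0 supplies the bound [u]^p on the defects, uniform in
  n, which is all that the blow-up argument needs. Nonnegativity of the defects yields lam <=
  lambda_1; the opposite inequality comes from v itself as a competitor in the infimum. The seminorm
  only links points on a common horizontal or vertical line. The two directions are instances of one
  abstract energy, and they are combined at the end: inside a product box one vertical and one
  horizontal jump reach almost every point.\<close>

lemma powr_mvt: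
  fixes p x y :: real
  assumes "1 < p" "0 \<le> x" "x < y"
  obtains z where "x < z" "z < y" "y powr p - x powr p = (y - x) * (p * z powr (p - 1))"
proof -
  have "continuous_on {x..y} (\<lambda>t. t powr p)"
    using assms by (intro continuous_on_powr' continuous_intros) auto
  moreover have der: "((\<lambda>t. t powr p) has_real_derivative p * t powr (p - 1)) (at t)"
    if "x < t" for t
    using that assms by (auto intro!: derivative_eq_intros)
  ultimately obtain l z where "x < z" "z < y" "((\<lambda>t. t powr p) has_real_derivative l) (at z)"
      "y powr p - x powr p = (y - x) * l"
    using MVT[OF \<open>x < y\<close>] by (metis real_differentiable_def)
  then show ?thesis
    using der that DERIV_unique by blast
qed

text \<open>Strict convexity of the power: the slope from the mean value theorem is compared
  strictly with the derivative at m. Strictness later identifies the equality case of Picone. The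
  point x = 0 is harmless because derivatives are used only inside the interval.\<close>

lemma powr_above_tangent:
  fixes p x m :: real
  assumes p: "1 < p" and x: "0 \<le> x" and m: "0 < m" and ne: "x \<noteq> m"
  shows "m powr p + p * m powr (p - 1) * (x - m) < x powr p"
proof -
  consider "x < m" | "m < x" using ne by linarith
  then show ?thesis
  proof cases
    case 1
    then obtain z where z: "x < z" "z < m" "m powr p - x powr p = (m - x) * (p * z powr (p - 1))"
      using powr_mvt p x by blast
    have "z powr (p - 1) < m powr (p - 1)"
      using z x p by (intro powr_less_mono2) auto
    then have "(m - x) * (p * z powr (p - 1)) < (m - x) * (p * m powr (p - 1))"
      using 1 p by simp
    then show ?thesis using z(3) by (simp add: algebra_simps)
  next
    case 2
    then obtain z where z: "m < z" "z < x" "x powr p - m powr p = (x - m) * (p * z powr (p - 1))"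
      using powr_mvt p m by (metis less_eq_real_def)
    have "m powr (p - 1) < z powr (p - 1)"
      using z m p by (intro powr_less_mono2) auto
    then have "(x - m) * (p * m powr (p - 1)) < (x - m) * (p * z powr (p - 1))"
      using 2 p by simp
    then show ?thesis using z(3) by (simp add: algebra_simps)
  qed
qed

lemma powr_diff_le:
  fixes p x y N :: real
  assumes p: "1 < p" and "0 \<le> x" "x \<le> N" "0 \<le> y" "y \<le> N"
  shows "\<bar>x powr p - y powr p\<bar> \<le> p * N powr (p - 1) * \<bar>x - y\<bar>"
proof -
  have *: "\<bar>b powr p - a powr p\<bar> \<le> p * N powr (p - 1) * \<bar>b - a\<bar>"
    if ab: "0 \<le> a" "a < b" "b \<le> N" for a b
  proof -
    obtain z where z: "a < z" "z < b" "b powr p - a powr p = (b - a) * (p * z powr (p - 1))"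
      using powr_mvt p ab by blast
    have "z powr (p - 1) \<le> N powr (p - 1)"
      using z ab p by (intro powr_mono2) auto
    then have "(b - a) * (p * z powr (p - 1)) \<le> (b - a) * (p * N powr (p - 1))"
      using ab p by (intro mult_left_mono) auto
    moreover have "0 \<le> (b - a) * (p * z powr (p - 1))" using ab p by simp
    ultimately show ?thesis using z(3) ab by (simp add: algebra_simps)
  qed
  consider "x < y" | "y < x" | "x = y" by linarith
  then show ?thesis
    by cases (use * [of x y] * [of y x] assms in \<open>auto simp: abs_minus_commute\<close>)
qed

lemma powr_neg_diff_le:
  fixes q x y e :: real
  assumes q: "0 < q" and e: "0 < e" and "e \<le> x" "e \<le> y"
  shows "\<bar>x powr (-q) - y powr (-q)\<bar> \<le> q * e powr (-q - 1) * \<bar>x - y\<bar>"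
proof -
  have *: "\<bar>b powr (-q) - a powr (-q)\<bar> \<le> q * e powr (-q - 1) * \<bar>b - a\<bar>"
    if ab: "e \<le> a" "a < b" for a b
  proof -
    have "((\<lambda>t. t powr (-q)) has_real_derivative (-q) * t powr (-q - 1)) (at t)"
      if "a \<le> t" for t
      using that ab e by (auto intro!: derivative_eq_intros)
    then obtain z where z: "a < z" "z < b"
        "b powr (-q) - a powr (-q) = (b - a) * ((-q) * z powr (-q - 1))"
      using MVT2[of a b "\<lambda>t. t powr (-q)" "\<lambda>t. (-q) * t powr (-q - 1)"] ab by blast
    have "z powr (-q - 1) \<le> e powr (-q - 1)"
      using z ab q e by (intro powr_mono2') auto
    then have "(b - a) * (q * z powr (-q - 1)) \<le> (b - a) * (q * e powr (-q - 1))"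
      using ab q by (intro mult_left_mono) auto
    moreover have "0 \<le> (b - a) * (q * z powr (-q - 1))" using ab q by simp
    ultimately show ?thesis using z(3) ab by (simp add: algebra_simps)
  qed
  consider "x < y" | "y < x" | "x = y" by linarith
  then show ?thesis
    by cases (use * [of x y] * [of y x] assms in \<open>auto simp: abs_minus_commute\<close>)
qed

lemma spow_minus: "spow (- a) q = - spow a q"
  by (simp add: spow_def sgn_minus)

lemma abs_spow: "\<bar>spow a q\<bar> = \<bar>a\<bar> powr q"
  by (simp add: spow_def abs_mult abs_sgn_eq)

lemma spow_times_self: "spow a (p - 1) * a = \<bar>a\<bar> powr p"
proof (cases "a = 0")
  case False
  have "spow a (p - 1) * a = \<bar>a\<bar> powr (p - 1) * \<bar>a\<bar>"
    by (simp add: spow_def sgn_if)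
  also have "\<dots> = \<bar>a\<bar> powr (p - 1) * \<bar>a\<bar> powr 1" by simp
  also have "\<dots> = \<bar>a\<bar> powr p" by (subst powr_add [symmetric]) simp
  finally show ?thesis .
qed (simp add: spow_def)

text \<open>With a, b the values of u and c, d those of v at two points, this is the integrand of
  the energy of u minus that of the weak form of v tested with u^p / v^(p-1); the factor
  \<open>c powr (1 - p)\<close> stands for the division.\<close>

definition picone :: "real \<Rightarrow> real \<Rightarrow> real \<Rightarrow> real \<Rightarrow> real \<Rightarrow> real" where
  "picone p a b c d = \<bar>a - b\<bar> powr p
     - spow (c - d) (p - 1) * (a powr p * c powr (1 - p) - b powr p * d powr (1 - p))"

lemma picone_swap: "picone p b a d c = picone p a b c d"
  unfolding picone_def abs_minus_commute[of b a]
  using spow_minus[of "c - d" "p - 1"] by (simp add: algebra_simps)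

text \<open>The expression is homogeneous of degree 0 in (c, d), so only t = d / c matters. The
  claim then becomes convexity of the p-th power for the weights 1 - t and t, read off from the
  tangent at a.\<close>

lemma picone_aux:
  fixes a b c d p :: real
  assumes p: "1 < p" and ab: "0 \<le> a" "0 \<le> b" and cd: "0 < d" "d < c"
  shows "0 \<le> picone p a b c d \<and> (picone p a b c d = 0 \<longrightarrow> a * d = b * c)"
proof -
  define t where "t = d / c"
  have t: "0 < t" "t < 1" using cd by (auto simp: t_def)
  \<comment> \<open>Dividing by the weights makes the weighted mean of X and Y equal to |a - b| + b,
    while the weighted p-th powers absorb the factors (1 - t)^(1-p) and t^(1-p).\<close>
  define X Y where "X = \<bar>a - b\<bar> / (1 - t)" and "Y = b / t"
  have scale: "\<theta> * (r / \<theta>) powr p = r powr p * \<theta> powr (1 - p)" if "0 < \<theta>" "0 \<le> r" for \<theta> r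
  proof -
    have "\<theta> * (r / \<theta>) powr p = \<theta> powr 1 * (r powr p / \<theta> powr p)"
      using that by (simp add: powr_divide)
    also have "\<dots> = r powr p * \<theta> powr (1 - p)"
      using that by (simp add: powr_diff)
    finally show ?thesis .
  qed
  have split: "picone p a b c d
      = (1 - t) powr (p - 1) * ((1 - t) * X powr p + t * Y powr p - a powr p)"
  proof -
    have c1: "(c - d) powr (p - 1) = c powr (p - 1) * (1 - t) powr (p - 1)"
    proof -
      have "c - d = c * (1 - t)" using cd by (simp add: t_def field_simps)
      then show ?thesis using cd t by (simp add: powr_mult)
    qed
    have c2: "c powr (p - 1) * c powr (1 - p) = 1"
      using cd by (simp flip: powr_add)
    have c3: "c powr (p - 1) * d powr (1 - p) = t powr (1 - p)"
    proof -
      have "t powr (1 - p) = d powr (1 - p) / c powr (1 - p)"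
        using cd by (simp add: t_def powr_divide)
      also have "\<dots> = d powr (1 - p) * c powr (p - 1)"
        using cd c2 by (simp add: nonzero_divide_eq_eq)
      finally show ?thesis by simp
    qed
    have c4: "(1 - t) powr (p - 1) * (1 - t) powr (1 - p) = 1"
      using t by (simp flip: powr_add)
    have "picone p a b c d = \<bar>a - b\<bar> powr p
        - (1 - t) powr (p - 1) * (a powr p * (c powr (p - 1) * c powr (1 - p))
             - b powr p * (c powr (p - 1) * d powr (1 - p)))"
      using cd by (simp add: picone_def spow_def c1 algebra_simps)
    also have "\<dots> = \<bar>a - b\<bar> powr p * ((1 - t) powr (p - 1) * (1 - t) powr (1 - p))
        - (1 - t) powr (p - 1) * (a powr p - b powr p * t powr (1 - p))"
      unfolding c2 c3 c4 by simp
    also have "\<dots> = (1 - t) powr (p - 1) * ((1 - t) * X powr p + t * Y powr p - a powr p)"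
    proof -
      have 1: "(1 - t) * X powr p = \<bar>a - b\<bar> powr p * (1 - t) powr (1 - p)"
        unfolding X_def using t by (intro scale) auto
      have 2: "t * Y powr p = b powr p * t powr (1 - p)"
        unfolding Y_def using t ab by (intro scale) auto
      show ?thesis unfolding 1 2 by (simp add: algebra_simps)
    qed
    finally show ?thesis .
  qed
  have pos: "0 < (1 - t) powr (p - 1)" using t by simp
  show ?thesis
  proof (cases "a = 0")
    \<comment> \<open>The tangent inequality needs a positive base point. Here the bracket is a sum
      of two nonnegative terms, so each vanishes in the equality case.\<close>
    case True
    have "0 \<le> (1 - t) * X powr p" "0 \<le> t * Y powr p" using t by simp_all
    moreover have "b = 0" if "t * Y powr p = 0"
      using that t by (simp add: Y_def)
    ultimately show ?thesis
      unfolding split using True pos by (auto simp: add_nonneg_eq_0_iff)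
  next
    case False
    then have a: "0 < a" using ab by simp
    have XY: "0 \<le> X" "0 \<le> Y" using t ab by (auto simp: X_def Y_def)
    define l where "l x = a powr p + p * a powr (p - 1) * (x - a)" for x
    have tan: "l x \<le> x powr p" "x powr p = l x \<longrightarrow> x = a" if "0 \<le> x" for x
      using powr_above_tangent[OF p that a] by (cases "x = a"; force simp: l_def)+
    have "(1 - t) * l X + t * l Y = a powr p + p * a powr (p - 1) * ((1 - t) * X + t * Y - a)"
      by (simp add: l_def algebra_simps)
    also have "(1 - t) * X + t * Y = \<bar>a - b\<bar> + b"
      using t by (simp add: X_def Y_def)
    \<comment> \<open>The mean |a - b| + b is at least a, and the line l has nonnegative
      slope.\<close>
    finally have lin: "a powr p \<le> (1 - t) * l X + t * l Y"
      using p by simp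
    have tX: "(1 - t) * l X \<le> (1 - t) * X powr p"
      using tan(1)[OF XY(1)] t by (intro mult_left_mono) auto
    have tY: "t * l Y \<le> t * Y powr p"
      using tan(1)[OF XY(2)] t by (intro mult_left_mono) auto
    \<comment> \<open>Equality makes both tangent inequalities sharp; as t > 0, strict convexity
      gives Y = a, that is b / t = a.\<close>
    have "a * d = b * c" if "(1 - t) * X powr p + t * Y powr p = a powr p"
    proof -
      have "t * Y powr p = t * l Y" using lin tX tY that by linarith
      then have "Y = a" using tan(2)[OF XY(2)] t by simp
      then show ?thesis using cd by (simp add: Y_def t_def field_simps)
    qed
    moreover have "0 \<le> (1 - t) * X powr p + t * Y powr p - a powr p"
      using lin tX tY by linarith
    ultimately show ?thesis
      unfolding split using pos by simp
  qed
qed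

lemma picone_nonneg:
  assumes "1 < p" "0 \<le> a" "0 \<le> b" "0 < c" "0 < d"
  shows "0 \<le> picone p a b c d"
proof (cases c d rule: linorder_cases)
  case equal
  then show ?thesis by (simp add: picone_def spow_def)
qed (use assms picone_aux[of p a b d c] picone_aux[of p b a c d] picone_swap[of p a b c d] in auto)

lemma picone_eq_0:
  assumes "1 < p" "0 \<le> a" "0 \<le> b" "0 < c" "0 < d" "picone p a b c d = 0"
  shows "a * d = b * c"
proof (cases c d rule: linorder_cases)
  case equal
  then show ?thesis using assms by (simp add: picone_def spow_def)
qed (use assms picone_aux[of p a b d c] picone_aux[of p b a c d] picone_swap[of p a b c d] in auto)

section \<open>Limits of the Picone expression as the cap and the shift are removed\<close>

lemma tendsto_inverse_Suc: "(\<lambda>n. c + inverse (real (Suc n))) \<longlonglongrightarrow> c"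
  using LIMSEQ_inverse_real_of_nat_add .

lemma eventually_min_Suc: "eventually (\<lambda>n. min a (real (Suc n)) = a) sequentially"
proof -
  obtain N where "a \<le> real N" using real_arch_simple by blast
  then show ?thesis
    unfolding eventually_sequentially by (intro exI[of _ N]) (auto simp: min_def)
qed

text \<open>The common shift e cancels in the difference c - d: the weak form of v is left
  untouched, and only the powers in the test function see the shifted values.\<close>

lemma picone_shift:
  "picone p a b (c + e) (d + e) = \<bar>a - b\<bar> powr p
     - spow (c - d) (p - 1) * (a powr p * (c + e) powr (1 - p) - b powr p * (d + e) powr (1 - p))"
  by (simp add: picone_def)

lemma picone_tendsto:
  assumes "0 < c" "0 < d"
  shows "(\<lambda>n. picone p (min a (real (Suc n))) (min b (real (Suc n)))
      (c + inverse (real (Suc n))) (d + inverse (real (Suc n)))) \<longlonglongrightarrow> picone p a b c d"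
proof (rule Lim_transform_eventually)
  show "(\<lambda>n. picone p a b (c + inverse (real (Suc n))) (d + inverse (real (Suc n)))) \<longlonglongrightarrow> picone p a b c d"
    unfolding picone_shift unfolding picone_def using assms
    by (intro tendsto_intros tendsto_inverse_Suc) auto
  show "\<forall>\<^sub>F n in sequentially. picone p a b (c + inverse (real (Suc n))) (d + inverse (real (Suc n)))
      = picone p (min a (real (Suc n))) (min b (real (Suc n)))
      (c + inverse (real (Suc n))) (d + inverse (real (Suc n)))"
    using eventually_min_Suc[of a] eventually_min_Suc[of b] by eventually_elim simp
qed

text \<open>With c = 0 the factor \<open>spow (c - d) (p - 1)\<close> equals -d^(p-1), so the term
  with a enters as +d^(p-1) a^p (n+1)^(p-1), which is unbounded, while the remaining terms converge
  because d > 0.\<close>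

lemma picone_at_top:
  assumes p: "1 < p" and "0 < a" "0 < d"
  shows "filterlim (\<lambda>n. picone p (min a (real (Suc n))) (min b (real (Suc n)))
      (0 + inverse (real (Suc n))) (d + inverse (real (Suc n)))) at_top sequentially"
proof -
  have "filterlim (\<lambda>n. inverse (real (Suc n)) powr (1 - p)) at_top sequentially"
  proof -
    have "filterlim (\<lambda>n. ln (real (Suc n))) at_top sequentially"
      using filterlim_compose[OF ln_at_top filterlim_compose[OF filterlim_real_sequentially filterlim_Suc]] .
    then have "filterlim (\<lambda>n. (p - 1) * ln (real (Suc n))) at_top sequentially"
      using p by (intro filterlim_tendsto_pos_mult_at_top[OF tendsto_const]) auto
    from filterlim_compose[OF exp_at_top this] show ?thesis
      by (simp add: powr_def ln_inverse algebra_simps)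
  qed
  then have 1: "filterlim (\<lambda>n. (d powr (p - 1) * a powr p) * inverse (real (Suc n)) powr (1 - p)) at_top sequentially"
    using assms by (intro filterlim_tendsto_pos_mult_at_top[OF tendsto_const]) auto
  have 2: "(\<lambda>n. \<bar>a - b\<bar> powr p - d powr (p - 1) * (b powr p * (d + inverse (real (Suc n))) powr (1 - p)))
      \<longlonglongrightarrow> \<bar>a - b\<bar> powr p - d powr (p - 1) * (b powr p * d powr (1 - p))"
    using assms by (intro tendsto_intros tendsto_inverse_Suc) auto
  have "filterlim (\<lambda>n. picone p a b (0 + inverse (real (Suc n))) (d + inverse (real (Suc n)))) at_top sequentially"
    using filterlim_tendsto_add_at_top[OF 2 1] assms(3)
    unfolding picone_shift by (simp add: spow_def algebra_simps)
  moreover have "\<forall>\<^sub>F n in sequentially. picone p (min a (real (Suc n))) (min b (real (Suc n)))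
      (0 + inverse (real (Suc n))) (d + inverse (real (Suc n)))
    = picone p a b (0 + inverse (real (Suc n))) (d + inverse (real (Suc n)))"
    using eventually_min_Suc[of a] eventually_min_Suc[of b] by eventually_elim simp
  ultimately show ?thesis
    by (simp add: filterlim_cong[OF refl refl])
qed

text \<open>A crude Young inequality, proved by replacing the smaller of |a| and |b| by the larger.
  It makes the weak form integrable as soon as both energies are finite.\<close>

lemma powr_times_le_add:
  fixes a b :: real
  assumes "1 < p"
  shows "\<bar>a\<bar> powr (p - 1) * \<bar>b\<bar> \<le> \<bar>a\<bar> powr p + \<bar>b\<bar> powr p"
proof -
  have *: "\<bar>x\<bar> powr (p - 1) * \<bar>x\<bar> = \<bar>x\<bar> powr p" for x
    using spow_times_self[of "\<bar>x\<bar>" p] by (cases "x = 0") (simp_all add: spow_def)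
  show ?thesis
  proof (cases "\<bar>b\<bar> \<le> \<bar>a\<bar>")
    case True
    then have "\<bar>a\<bar> powr (p - 1) * \<bar>b\<bar> \<le> \<bar>a\<bar> powr (p - 1) * \<bar>a\<bar>" by (intro mult_left_mono) auto
    then show ?thesis unfolding * by (simp add: add_increasing2)
  next
    case False
    then have "\<bar>a\<bar> powr (p - 1) * \<bar>b\<bar> \<le> \<bar>b\<bar> powr (p - 1) * \<bar>b\<bar>"
      using assms by (intro mult_right_mono powr_mono2) auto
    then show ?thesis unfolding * by (simp add: add_increasing)
  qed
qed

lemma powr_add_le:
  fixes a b :: real
  assumes "0 < p" "0 \<le> a" "0 \<le> b"
  shows "(a + b) powr p \<le> 2 powr p * (a powr p + b powr p)"
proof -
  have "(a + b) powr p \<le> (2 * max a b) powr p"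
    using assms by (intro powr_mono2) auto
  also have "\<dots> = 2 powr p * max a b powr p"
    by (rule powr_mult)
  also have "max a b powr p \<le> a powr p + b powr p" by (auto simp: max_def)
  finally show ?thesis by simp
qed

section \<open>The truncated test function and its Lipschitz bound\<close>

definition trunc :: "nat \<Rightarrow> real \<Rightarrow> real" where
  "trunc n a = min (max 0 a) (real (Suc n))"

text \<open>The admissible approximation of Picone's test function \<open>u\<^sup>p / v\<^sup>p\<^sup>-\<^sup>1\<close>.\<close>

definition testfun :: "real \<Rightarrow> nat \<Rightarrow> real \<Rightarrow> real \<Rightarrow> real" where
  "testfun p n a c = trunc n a powr p * (max 0 c + inverse (real (Suc n))) powr (1 - p)"

lemma trunc_bounds: "0 \<le> trunc n a" "trunc n a \<le> real (Suc n)" "trunc n a \<le> \<bar>a\<bar>"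
  by (auto simp: trunc_def)

lemma abs_trunc_diff_le: "\<bar>trunc n a - trunc n b\<bar> \<le> \<bar>a - b\<bar>"
  by (auto simp: trunc_def min_def max_def)

text \<open>The cap bounds the derivative of the p-th power, and the shift keeps the base of the
  negative power above 1 / (n+1). The constant depends on n, which is harmless: it serves only to
  show that the test function is admissible.\<close>

lemma testfun_lipschitz:
  assumes p: "1 < p"
  shows "\<exists>C\<ge>0. \<forall>a b c d. \<bar>testfun p n a c - testfun p n b d\<bar> \<le> C * (\<bar>a - b\<bar> + \<bar>c - d\<bar>)"
proof -
  define N e where "N = real (Suc n)" and "e = inverse (real (Suc n))"
  have e: "0 < e" by (simp add: e_def)
  \<comment> \<open>The two halves of a product rule: the Lipschitz constant of one factor times the
    supremum of the other.\<close>
  define K1 K2 where "K1 = p * N powr (p - 1) * e powr (1 - p)"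
    and "K2 = N powr p * ((p - 1) * e powr (-(p - 1) - 1))"
  have K: "0 \<le> K1" "0 \<le> K2" using p by (simp_all add: K1_def K2_def)
  have "\<bar>testfun p n a c - testfun p n b d\<bar> \<le> (K1 + K2) * (\<bar>a - b\<bar> + \<bar>c - d\<bar>)" for a b c d
  proof -
    define A B C D where "A = trunc n a" and "B = trunc n b"
      and "C = max 0 c + e" and "D = max 0 d + e"
    have bnds: "0 \<le> A" "A \<le> N" "0 \<le> B" "B \<le> N" "e \<le> C" "e \<le> D"
      using trunc_bounds by (auto simp: A_def B_def C_def D_def N_def)
    have AB: "\<bar>A powr p - B powr p\<bar> \<le> p * N powr (p - 1) * \<bar>a - b\<bar>"
    proof -
      have "\<bar>A powr p - B powr p\<bar> \<le> p * N powr (p - 1) * \<bar>A - B\<bar>"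
        using powr_diff_le[OF p] bnds by blast
      also have "\<dots> \<le> p * N powr (p - 1) * \<bar>a - b\<bar>"
        using p unfolding A_def B_def by (intro mult_left_mono abs_trunc_diff_le) auto
      finally show ?thesis .
    qed
    have CD: "\<bar>C powr (1 - p) - D powr (1 - p)\<bar> \<le> (p - 1) * e powr (-(p - 1) - 1) * \<bar>c - d\<bar>"
    proof -
      have "\<bar>C powr (-(p - 1)) - D powr (-(p - 1))\<bar> \<le> (p - 1) * e powr (-(p - 1) - 1) * \<bar>C - D\<bar>"
        using powr_neg_diff_le[of "p - 1" e C D] bnds e p by simp
      also have "\<bar>C - D\<bar> \<le> \<bar>c - d\<bar>" by (auto simp: C_def D_def)
      then have "(p - 1) * e powr (-(p - 1) - 1) * \<bar>C - D\<bar> \<le> (p - 1) * e powr (-(p - 1) - 1) * \<bar>c - d\<bar>"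
        using p by (intro mult_left_mono) auto
      finally show ?thesis by simp
    qed
    have "testfun p n a c - testfun p n b d
        = (A powr p - B powr p) * C powr (1 - p) + B powr p * (C powr (1 - p) - D powr (1 - p))"
      by (simp add: testfun_def A_def B_def C_def D_def e_def algebra_simps)
    then have "\<bar>testfun p n a c - testfun p n b d\<bar>
        \<le> \<bar>(A powr p - B powr p) * C powr (1 - p)\<bar> + \<bar>B powr p * (C powr (1 - p) - D powr (1 - p))\<bar>"
      by linarith
    also have "\<dots> = \<bar>A powr p - B powr p\<bar> * C powr (1 - p) + B powr p * \<bar>C powr (1 - p) - D powr (1 - p)\<bar>"
      by (simp add: abs_mult)
    also have "\<bar>A powr p - B powr p\<bar> * C powr (1 - p)
        \<le> (p * N powr (p - 1) * \<bar>a - b\<bar>) * e powr (1 - p)"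
      using AB p e bnds by (intro mult_mono powr_mono2') auto
    also have "B powr p * \<bar>C powr (1 - p) - D powr (1 - p)\<bar>
        \<le> N powr p * ((p - 1) * e powr (-(p - 1) - 1) * \<bar>c - d\<bar>)"
      using CD p bnds by (intro mult_mono powr_mono2) auto
    finally have "\<bar>testfun p n a c - testfun p n b d\<bar> \<le> K1 * \<bar>a - b\<bar> + K2 * \<bar>c - d\<bar>"
      by (simp add: K1_def K2_def algebra_simps)
    also have "\<dots> \<le> (K1 + K2) * (\<bar>a - b\<bar> + \<bar>c - d\<bar>)"
      using K by (simp add: algebra_simps)
    finally show ?thesis .
  qed
  then show ?thesis using K by (intro exI[of _ "K1 + K2"]) auto
qed

lemma testfun_0 [simp]: "testfun p n 0 c = 0"
  by (simp add: testfun_def trunc_def)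

lemma testfun_measurable [measurable]:
  assumes [measurable]: "u \<in> borel_measurable M" "v \<in> borel_measurable M"
  shows "(\<lambda>w. testfun p n (u w) (v w)) \<in> borel_measurable M"
  unfolding testfun_def trunc_def by measurable

subsection \<open>Nonlocal energies\<close>

text \<open>M is a weighted measure on a space of jumps, and P, Q give the two ends of a jump. The
  last two assumptions say that neither end charges a Lebesgue null set, so that signs and
  positivity known only a.e. can be used at both ends.\<close>

locale jump =
  fixes M :: "'m measure" and P Q :: "'m \<Rightarrow> 'c::euclidean_space"
  assumes P [measurable]: "P \<in> M \<rightarrow>\<^sub>M borel" and Q [measurable]: "Q \<in> M \<rightarrow>\<^sub>M borel"
    and AE_P: "\<And>R. (AE w in lborel. R w) \<Longrightarrow> AE x in M. R (P x)"
    and AE_Q: "\<And>R. (AE w in lborel. R w) \<Longrightarrow> AE x in M. R (Q x)"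
begin

definition energy :: "real \<Rightarrow> ('c \<Rightarrow> real) \<Rightarrow> ennreal" where
  "energy p u = (\<integral>\<^sup>+x. ennreal (\<bar>u (P x) - u (Q x)\<bar> powr p) \<partial>M)"

definition form :: "real \<Rightarrow> ('c \<Rightarrow> real) \<Rightarrow> ('c \<Rightarrow> real) \<Rightarrow> real" where
  "form p u \<phi> = (\<integral>x. spow (u (P x) - u (Q x)) (p - 1) * (\<phi> (P x) - \<phi> (Q x)) \<partial>M)"

lemma integrable_powr:
  assumes [measurable]: "u \<in> borel_measurable borel" and "energy p u < \<infinity>"
  shows "integrable M (\<lambda>x. \<bar>u (P x) - u (Q x)\<bar> powr p)"
  using assms(2) unfolding energy_def by (intro integrableI_nonneg) auto

lemma energy_eq:
  assumes [measurable]: "u \<in> borel_measurable borel"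
  shows "enn2real (energy p u) = (\<integral>x. \<bar>u (P x) - u (Q x)\<bar> powr p \<partial>M)"
  unfolding energy_def by (subst integral_eq_nn_integral) auto

lemma form_self:
  assumes "u \<in> borel_measurable borel"
  shows "form p u u = enn2real (energy p u)"
  unfolding form_def energy_eq[OF assms] spow_times_self ..

lemma integrable_form:
  assumes [measurable]: "u \<in> borel_measurable borel" "\<phi> \<in> borel_measurable borel"
    and "1 < p" "energy p u < \<infinity>" "energy p \<phi> < \<infinity>"
  shows "integrable M (\<lambda>x. spow (u (P x) - u (Q x)) (p - 1) * (\<phi> (P x) - \<phi> (Q x)))"
proof (rule Bochner_Integration.integrable_bound)
  show "integrable M (\<lambda>x. \<bar>u (P x) - u (Q x)\<bar> powr p + \<bar>\<phi> (P x) - \<phi> (Q x)\<bar> powr p)"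
    using assms by (intro Bochner_Integration.integrable_add integrable_powr)
  show "(\<lambda>x. spow (u (P x) - u (Q x)) (p - 1) * (\<phi> (P x) - \<phi> (Q x))) \<in> borel_measurable M"
    unfolding spow_def by measurable
  show "AE x in M. norm (spow (u (P x) - u (Q x)) (p - 1) * (\<phi> (P x) - \<phi> (Q x)))
      \<le> norm (\<bar>u (P x) - u (Q x)\<bar> powr p + \<bar>\<phi> (P x) - \<phi> (Q x)\<bar> powr p)"
    using powr_times_le_add[OF assms(3)] by (intro AE_I2) (simp add: abs_mult abs_spow)
qed

lemma energy_finite_dominated:
  assumes [measurable]: "u \<in> borel_measurable borel" "v \<in> borel_measurable borel"
    "\<phi> \<in> borel_measurable borel"
    and "1 < p" and fin: "energy p u < \<infinity>" "energy p v < \<infinity>" and "0 \<le> C"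
    and le: "\<And>x y. \<bar>\<phi> x - \<phi> y\<bar> \<le> C * (\<bar>u x - u y\<bar> + \<bar>v x - v y\<bar>)"
  shows "energy p \<phi> < \<infinity>"
proof -
  have pw: "\<bar>\<phi> x - \<phi> y\<bar> powr p
      \<le> C powr p * 2 powr p * (\<bar>u x - u y\<bar> powr p + \<bar>v x - v y\<bar> powr p)" for x y
  proof -
    have "\<bar>\<phi> x - \<phi> y\<bar> powr p \<le> (C * (\<bar>u x - u y\<bar> + \<bar>v x - v y\<bar>)) powr p"
      using le assms(4) by (intro powr_mono2) auto
    also have "\<dots> = C powr p * (\<bar>u x - u y\<bar> + \<bar>v x - v y\<bar>) powr p" by (rule powr_mult)
    also have "\<dots> \<le> C powr p * (2 powr p * (\<bar>u x - u y\<bar> powr p + \<bar>v x - v y\<bar> powr p))"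
      using assms(4) by (intro mult_left_mono powr_add_le) auto
    finally show ?thesis by (simp add: mult.assoc)
  qed
  have "integrable M (\<lambda>x. C powr p * 2 powr p *
      (\<bar>u (P x) - u (Q x)\<bar> powr p + \<bar>v (P x) - v (Q x)\<bar> powr p))"
    using fin by (intro integrable_mult_right Bochner_Integration.integrable_add integrable_powr) auto
  then have "integrable M (\<lambda>x. \<bar>\<phi> (P x) - \<phi> (Q x)\<bar> powr p)"
  proof (rule Bochner_Integration.integrable_bound)
    show "AE x in M. norm (\<bar>\<phi> (P x) - \<phi> (Q x)\<bar> powr p) \<le> norm (C powr p * 2 powr p *
      (\<bar>u (P x) - u (Q x)\<bar> powr p + \<bar>v (P x) - v (Q x)\<bar> powr p))"
      using order_trans[OF pw abs_ge_self] by (intro AE_I2) simp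
  qed measurable
  then show ?thesis
    unfolding energy_def by (auto simp: integrable_iff_bounded)
qed

lemma energy_trunc_le: "1 < p \<Longrightarrow> energy p (\<lambda>w. trunc n (u w)) \<le> energy p u"
  unfolding energy_def
  by (intro nn_integral_mono ennreal_leI powr_mono2 abs_trunc_diff_le) auto

lemma energy_testfun:
  assumes "u \<in> borel_measurable borel" "v \<in> borel_measurable borel"
    and "1 < p" "energy p u < \<infinity>" "energy p v < \<infinity>"
  shows "energy p (\<lambda>w. testfun p n (u w) (v w)) < \<infinity>"
proof -
  obtain C where C: "0 \<le> C"
    "\<And>a b c d. \<bar>testfun p n a c - testfun p n b d\<bar> \<le> C * (\<bar>a - b\<bar> + \<bar>c - d\<bar>)"
    using testfun_lipschitz[OF assms(3), of n] by blast
  show ?thesis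
    by (rule energy_finite_dominated[OF assms(1,2) testfun_measurable[OF assms(1,2)] assms(3-5) C])
qed

text \<open>Truncation and positive parts make this nonnegative at every jump, although u and v are
  nonnegative only almost everywhere.\<close>

definition defect :: "real \<Rightarrow> ('c \<Rightarrow> real) \<Rightarrow> ('c \<Rightarrow> real) \<Rightarrow> nat \<Rightarrow> 'm \<Rightarrow> real" where
  "defect p u v n x = picone p (trunc n (u (P x))) (trunc n (u (Q x)))
     (max 0 (v (P x)) + inverse (real (Suc n))) (max 0 (v (Q x)) + inverse (real (Suc n)))"

lemma defect_nonneg: "1 < p \<Longrightarrow> 0 \<le> defect p u v n x"
  unfolding defect_def by (intro picone_nonneg trunc_bounds add_nonneg_pos) auto

lemma defect_measurable [measurable]:
  assumes [measurable]: "u \<in> borel_measurable borel" "v \<in> borel_measurable borel"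
  shows "defect p u v n \<in> borel_measurable M"
  unfolding defect_def trunc_def picone_def spow_def by measurable

text \<open>The second claim is stated separately because \<open>ennreal\<close> sends negative
  numbers to 0. It is what later allows the defect of one direction to be bounded by the sum over
  both.\<close>

lemma nn_integral_defect:
  assumes [measurable]: "u \<in> borel_measurable borel" "v \<in> borel_measurable borel"
    and p: "1 < p" and fin: "energy p u < \<infinity>" "energy p v < \<infinity>"
    and v: "AE w in lborel. 0 \<le> v w"
  shows "(\<integral>\<^sup>+x. ennreal (defect p u v n x) \<partial>M)
    = ennreal (enn2real (energy p (\<lambda>w. trunc n (u w))) - form p v (\<lambda>w. testfun p n (u w) (v w)))"
    and "0 \<le> enn2real (energy p (\<lambda>w. trunc n (u w))) - form p v (\<lambda>w. testfun p n (u w) (v w))"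
proof -
  let ?\<phi> = "\<lambda>w. testfun p n (u w) (v w)" and ?U = "\<lambda>w. trunc n (u w)"
  have [measurable]: "?U \<in> borel_measurable borel" unfolding trunc_def by measurable
  have "energy p ?U < \<infinity>" using energy_trunc_le[OF p, of n u] fin(1) by (rule le_less_trans)
  then have 1: "integrable M (\<lambda>x. \<bar>?U (P x) - ?U (Q x)\<bar> powr p)"
    by (intro integrable_powr) auto
  have 2: "integrable M (\<lambda>x. spow (v (P x) - v (Q x)) (p - 1) * (?\<phi> (P x) - ?\<phi> (Q x)))"
    using p fin by (intro integrable_form energy_testfun) auto
  \<comment> \<open>Off the null set of jumps with a negative value of v, the positive part
    disappears and the shift cancels.\<close>
  have eq: "AE x in M. defect p u v n x = \<bar>?U (P x) - ?U (Q x)\<bar> powr p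
      - spow (v (P x) - v (Q x)) (p - 1) * (?\<phi> (P x) - ?\<phi> (Q x))"
    using AE_P[OF v] AE_Q[OF v]
    by eventually_elim (simp add: defect_def picone_shift testfun_def max_absorb2)
  have int: "(\<integral>x. defect p u v n x \<partial>M) = enn2real (energy p ?U) - form p v ?\<phi>"
    unfolding form_def using 1 2
    by (subst integral_cong_AE[OF _ _ eq]) (simp_all add: energy_eq)
  have "integrable M (defect p u v n)"
    by (rule integrable_cong_AE_imp[OF Bochner_Integration.integrable_diff[OF 1 2]]) (use eq in auto)
  then show "(\<integral>\<^sup>+x. ennreal (defect p u v n x) \<partial>M)
    = ennreal (enn2real (energy p ?U) - form p v ?\<phi>)"
    unfolding int[symmetric] using defect_nonneg[OF p] by (intro nn_integral_eq_integral) auto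
  show "0 \<le> enn2real (energy p ?U) - form p v ?\<phi>"
    unfolding int[symmetric] using defect_nonneg[OF p] by (intro integral_nonneg_AE) auto
qed

lemma defect_tendsto:
  assumes "0 \<le> u (P x)" "0 \<le> u (Q x)" "0 < v (P x)" "0 < v (Q x)"
  shows "(\<lambda>n. defect p u v n x) \<longlonglongrightarrow> picone p (u (P x)) (u (Q x)) (v (P x)) (v (Q x))"
  unfolding defect_def trunc_def using picone_tendsto[OF assms(3,4)] assms by (simp add: max_absorb2)

lemma defect_at_top:
  assumes "1 < p" "0 < u (P x)" "0 \<le> u (Q x)" "v (P x) = 0" "0 < v (Q x)"
  shows "filterlim (\<lambda>n. defect p u v n x) at_top sequentially"
  unfolding defect_def trunc_def
  using picone_at_top[OF assms(1,2,5)] assms by (simp add: max_absorb2)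

lemma defect_at_top':
  assumes "1 < p" "0 \<le> u (P x)" "0 < u (Q x)" "0 < v (P x)" "v (Q x) = 0"
  shows "filterlim (\<lambda>n. defect p u v n x) at_top sequentially"
  unfolding defect_def trunc_def picone_swap[symmetric, of p "min (max 0 (u (P x))) _"]
  using picone_at_top[OF assms(1,3,4)] assms by (simp add: max_absorb2)

lemma fatou_defect:
  assumes [measurable]: "u \<in> borel_measurable borel" "v \<in> borel_measurable borel"
    and "\<And>n. (\<integral>\<^sup>+x. ennreal (defect p u v n x) \<partial>M) \<le> ennreal (c n)" "c \<longlonglongrightarrow> l"
  shows "(\<integral>\<^sup>+x. liminf (\<lambda>n. ennreal (defect p u v n x)) \<partial>M) \<le> ennreal l"
proof -
  have "(\<integral>\<^sup>+x. liminf (\<lambda>n. ennreal (defect p u v n x)) \<partial>M)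
      \<le> liminf (\<lambda>n. \<integral>\<^sup>+x. ennreal (defect p u v n x) \<partial>M)"
    by (rule nn_integral_liminf) simp
  also have "\<dots> \<le> liminf (\<lambda>n. ennreal (c n))"
    using assms(3) by (intro Liminf_mono always_eventually) auto
  also have "\<dots> = ennreal l"
    using assms(4) by (intro lim_imp_Liminf tendsto_ennrealI) auto
  finally show ?thesis .
qed

text \<open>Fatou with a constant majorant: the liminf of the defects is finite a.e., which is
  incompatible with divergence to infinity at jumps joining {v = 0} to {v > 0}.\<close>

lemma AE_same_sign:
  assumes [measurable]: "u \<in> borel_measurable borel" "v \<in> borel_measurable borel"
    and p: "1 < p" and u: "AE w in lborel. 0 \<le> u w" and v: "AE w in lborel. 0 \<le> v w"
    and "\<And>n. (\<integral>\<^sup>+x. ennreal (defect p u v n x) \<partial>M) \<le> ennreal c"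
  shows "AE x in M. 0 < u (P x) \<and> 0 < u (Q x) \<longrightarrow> (0 < v (P x) \<longleftrightarrow> 0 < v (Q x))"
proof -
  have "(\<integral>\<^sup>+x. liminf (\<lambda>n. ennreal (defect p u v n x)) \<partial>M) \<le> ennreal c"
    using assms(1,2,6) tendsto_const by (rule fatou_defect)
  then have "AE x in M. liminf (\<lambda>n. ennreal (defect p u v n x)) \<noteq> \<infinity>"
    by (intro nn_integral_PInf_AE) (auto simp: top_unique)
  then show ?thesis
    using AE_P[OF u] AE_Q[OF u] AE_P[OF v] AE_Q[OF v]
  proof eventually_elim
    case (elim x)
    have "\<not> filterlim (\<lambda>n. defect p u v n x) at_top sequentially"
    proof
      assume "filterlim (\<lambda>n. defect p u v n x) at_top sequentially"
      then have "(\<lambda>n. ennreal (defect p u v n x)) \<longlonglongrightarrow> top"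
        by (simp add: ennreal_tendsto_top_eq_at_top)
      then have "liminf (\<lambda>n. ennreal (defect p u v n x)) = top"
        by (intro lim_imp_Liminf) auto
      with elim show False by simp
    qed
    then have "\<not> (0 < u (P x) \<and> v (P x) = 0 \<and> 0 < v (Q x))"
      "\<not> (0 < u (Q x) \<and> v (Q x) = 0 \<and> 0 < v (P x))"
      using defect_at_top[OF p, of u x v] defect_at_top'[OF p, of u x v] elim by blast+
    then show ?case using elim by linarith
  qed
qed

text \<open>Where v is positive at both ends, the defects converge to the Picone expression of u and
  v; majorants tending to 0 force it to vanish, and the equality case applies.\<close>

lemma AE_proportional:
  assumes [measurable]: "u \<in> borel_measurable borel" "v \<in> borel_measurable borel"
    and p: "1 < p" and u: "AE w in lborel. 0 \<le> u w"
    and "\<And>n. (\<integral>\<^sup>+x. ennreal (defect p u v n x) \<partial>M) \<le> ennreal (c n)" "c \<longlonglongrightarrow> 0"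
  shows "AE x in M. 0 < v (P x) \<and> 0 < v (Q x) \<longrightarrow> u (P x) * v (Q x) = u (Q x) * v (P x)"
proof -
  have "(\<integral>\<^sup>+x. liminf (\<lambda>n. ennreal (defect p u v n x)) \<partial>M) \<le> ennreal 0"
    using assms(1,2,5,6) by (rule fatou_defect)
  then have "(\<integral>\<^sup>+x. liminf (\<lambda>n. ennreal (defect p u v n x)) \<partial>M) = 0" by simp
  then have "AE x in M. liminf (\<lambda>n. ennreal (defect p u v n x)) = 0"
    by (subst (asm) nn_integral_0_iff_AE) auto
  then show ?thesis
    using AE_P[OF u] AE_Q[OF u]
  proof eventually_elim
    case (elim x)
    show ?case
    proof (intro impI, elim conjE)
      assume pos: "0 < v (P x)" "0 < v (Q x)"
      have "(\<lambda>n. ennreal (defect p u v n x))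
          \<longlonglongrightarrow> ennreal (picone p (u (P x)) (u (Q x)) (v (P x)) (v (Q x)))"
        using elim pos by (intro tendsto_ennrealI defect_tendsto) auto
      then have "ennreal (picone p (u (P x)) (u (Q x)) (v (P x)) (v (Q x))) = 0"
        using elim(1) by (simp add: lim_imp_Liminf)
      then have "picone p (u (P x)) (u (Q x)) (v (P x)) (v (Q x)) = 0"
        using picone_nonneg[OF p elim(2,3) pos] by (simp add: ennreal_eq_0_iff)
      then show "u (P x) * v (Q x) = u (Q x) * v (P x)"
        using picone_eq_0[OF p elim(2,3) pos] by blast
    qed
  qed
qed

end

subsection \<open>Horizontal and vertical jumps\<close>

lemma AE_lborel_fst:
  assumes "AE x in lborel. R x"
  shows "AE w in (lborel :: ('c::euclidean_space \<times> 'd::euclidean_space) measure). R (fst w)"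
proof -
  obtain N where N: "N \<in> null_sets lborel" "{x. \<not> R x} \<subseteq> N"
    using assms by (auto simp: eventually_ae_filter)
  have [measurable]: "N \<in> sets borel" using N(1) by auto
  have "AE x in lborel. AE y in (lborel :: 'd measure). fst (x, y) \<notin> N"
    using AE_not_in[OF N(1)] by eventually_elim simp
  then have "AE w in (lborel :: 'c measure) \<Otimes>\<^sub>M (lborel :: 'd measure). fst w \<notin> N"
    by (intro lborel_pair.AE_pair_measure) measurable
  then show ?thesis
    unfolding lborel_prod by eventually_elim (use N(2) in auto)
qed

lemma AE_lborel_snd:
  assumes "AE y in lborel. R y"
  shows "AE w in (lborel :: ('c::euclidean_space \<times> 'd::euclidean_space) measure). R (snd w)"
proof -
  obtain N where N: "N \<in> null_sets lborel" "{x. \<not> R x} \<subseteq> N"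
    using assms by (auto simp: eventually_ae_filter)
  have [measurable]: "N \<in> sets borel" using N(1) by auto
  have "AE x in (lborel :: 'c measure). AE y in lborel. snd (x, y) \<notin> N"
    using AE_not_in[OF N(1)] by simp
  then have "AE w in (lborel :: 'c measure) \<Otimes>\<^sub>M (lborel :: 'd measure). snd w \<notin> N"
    by (intro lborel_pair.AE_pair_measure) measurable
  then show ?thesis
    unfolding lborel_prod by eventually_elim (use N(2) in auto)
qed

text \<open>On the singular set, where the second component equals r of the first, the density takes
  the value 1 / 0 = 0 instead of infinity.\<close>

definition jump_measure ::
  "('w::euclidean_space \<Rightarrow> 'c::euclidean_space) \<Rightarrow> real \<Rightarrow> ('w \<times> 'c) measure" where
  "jump_measure r \<kappa> = density lborel (\<lambda>x. ennreal (1 / norm (r (fst x) - snd x) powr \<kappa>))"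

lemma borel_measurable_jump:
  "borel_measurable (jump_measure r \<kappa>) = borel_measurable borel"
  "g \<in> jump_measure r \<kappa> \<rightarrow>\<^sub>M N \<longleftrightarrow> g \<in> borel \<rightarrow>\<^sub>M N"
  by (auto simp: jump_measure_def intro!: measurable_cong_sets)

lemma kernel_measurable:
  fixes r :: "'w::euclidean_space \<Rightarrow> 'c::euclidean_space"
  assumes [measurable]: "r \<in> borel_measurable borel"
  shows "(\<lambda>x. 1 / norm (r (fst x) - snd x) powr \<kappa>) \<in> borel_measurable borel"
  unfolding borel_prod [symmetric] by measurable

lemma nn_integral_jump:
  fixes r :: "'w::euclidean_space \<Rightarrow> 'c::euclidean_space"
  assumes r: "r \<in> borel_measurable borel" and g: "g \<in> borel_measurable borel"
  shows "(\<integral>\<^sup>+x. ennreal (g x) \<partial>jump_measure r \<kappa>)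
    = (\<integral>\<^sup>+w. \<integral>\<^sup>+z. ennreal (g (w, z) / norm (r w - z) powr \<kappa>) \<partial>lborel \<partial>lborel)"
proof -
  have "(\<integral>\<^sup>+x. ennreal (g x) \<partial>jump_measure r \<kappa>)
      = (\<integral>\<^sup>+x. ennreal (1 / norm (r (fst x) - snd x) powr \<kappa>) * ennreal (g x) \<partial>lborel)"
    unfolding jump_measure_def using kernel_measurable[OF r] g
    by (intro nn_integral_density) auto
  also have "\<dots> = (\<integral>\<^sup>+x. ennreal (g x / norm (r (fst x) - snd x) powr \<kappa>) \<partial>(lborel \<Otimes>\<^sub>M lborel))"
    unfolding lborel_prod by (simp flip: ennreal_mult')
  also have "\<dots> = (\<integral>\<^sup>+w. \<integral>\<^sup>+z. ennreal (g (w, z) / norm (r w - z) powr \<kappa>) \<partial>lborel \<partial>lborel)"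
    using borel_measurable_times[OF g kernel_measurable[OF r]]
    by (subst lborel.nn_integral_fst [symmetric]) (auto simp: lborel_prod)
  finally show ?thesis .
qed

text \<open>Iterated Bochner integrals, the shape in which \<open>H_form\<close> is given, agree
  with the integral over the product only under integrability; hence the finite energies assumed in
  \<open>H_form_eq\<close>.\<close>

lemma integral_jump:
  fixes r :: "'w::euclidean_space \<Rightarrow> 'c::euclidean_space" and g :: "_ \<Rightarrow> real"
  assumes r: "r \<in> borel_measurable borel" and g: "integrable (jump_measure r \<kappa>) g"
  shows "(\<integral>x. g x \<partial>jump_measure r \<kappa>)
    = (\<integral>w. \<integral>z. g (w, z) / norm (r w - z) powr \<kappa> \<partial>lborel \<partial>lborel)"
proof -
  have [measurable]: "g \<in> borel_measurable lborel"
    using borel_measurable_integrable[OF g] by (simp add: borel_measurable_jump)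
  have [measurable]: "(\<lambda>x. 1 / norm (r (fst x) - snd x) powr \<kappa>) \<in> borel_measurable lborel"
    using kernel_measurable[OF r] by simp
  have "integrable lborel (\<lambda>x. g x / norm (r (fst x) - snd x) powr \<kappa>)"
    using g unfolding jump_measure_def by (subst (asm) integrable_density) auto
  then have "integrable (lborel \<Otimes>\<^sub>M lborel) (\<lambda>x. g x / norm (r (fst x) - snd x) powr \<kappa>)"
    by (simp add: lborel_prod)
  from lborel_pair.integral_fst'[OF this]
  have "(\<integral>w. \<integral>z. g (w, z) / norm (r w - z) powr \<kappa> \<partial>lborel \<partial>lborel)
      = (\<integral>x. g x / norm (r (fst x) - snd x) powr \<kappa> \<partial>lborel)"
    by (simp add: lborel_prod)
  also have "\<dots> = (\<integral>x. g x \<partial>jump_measure r \<kappa>)"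
    unfolding jump_measure_def by (subst integral_density) auto
  finally show ?thesis ..
qed

lemma AE_jumpI:
  assumes "r \<in> borel_measurable borel" "AE x in lborel. R x"
  shows "AE x in jump_measure r \<kappa>. R x"
  unfolding jump_measure_def using assms(2) kernel_measurable[OF assms(1)]
  by (subst AE_density) (auto elim: eventually_mono)

text \<open>The hypothesis says nothing where the density vanishes, but for fixed w this is the
  single point z = r w.\<close>

lemma AE_jumpD:
  fixes r :: "'w::euclidean_space \<Rightarrow> 'c::euclidean_space"
  assumes "r \<in> borel_measurable borel" "AE x in jump_measure r \<kappa>. R x"
  shows "AE w in lborel. AE z in lborel. R (w, z)"
proof -
  have "AE x in lborel \<Otimes>\<^sub>M lborel. 0 < ennreal (1 / norm (r (fst x) - snd x) powr \<kappa>) \<longrightarrow> R x"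
    using assms kernel_measurable[OF assms(1)] unfolding jump_measure_def lborel_prod
    by (subst (asm) AE_density) auto
  from lborel_pair.AE_pair[OF this] show ?thesis
  proof eventually_elim
    case (elim w)
    then show ?case
      using AE_lborel_singleton[of "r w"] by eventually_elim auto
  qed
qed

definition hor_end :: "('a \<times> 'b) \<times> 'a \<Rightarrow> 'a \<times> 'b" where "hor_end x = (snd x, snd (fst x))"

definition ver_end :: "('a \<times> 'b) \<times> 'b \<Rightarrow> 'a \<times> 'b" where "ver_end x = (fst (fst x), snd x)"

lemma hor_end_measurable [measurable]:
  "(hor_end :: ('a::euclidean_space \<times> 'b::euclidean_space) \<times> 'a \<Rightarrow> _) \<in> borel_measurable borel"
  unfolding hor_end_def by (intro borel_measurable_continuous_onI continuous_intros)

lemma ver_end_measurable [measurable]: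
  "(ver_end :: ('a::euclidean_space \<times> 'b::euclidean_space) \<times> 'b \<Rightarrow> _) \<in> borel_measurable borel"
  unfolding ver_end_def by (intro borel_measurable_continuous_onI continuous_intros)

lemma fst_snd_borel [measurable]:
  "(fst :: 'a::euclidean_space \<times> 'b::euclidean_space \<Rightarrow> _) \<in> borel_measurable borel"
  "(snd :: 'a::euclidean_space \<times> 'b::euclidean_space \<Rightarrow> _) \<in> borel_measurable borel"
  by (intro borel_measurable_continuous_onI continuous_intros)+

text \<open>The end point of a jump from (x, y) to (z, y) does not depend on x, so the preimage of a
  null set is a product in that variable and is null by Fubini.\<close>

lemma AE_hor_end:
  fixes R :: "'a::euclidean_space \<times> 'b::euclidean_space \<Rightarrow> bool"
  assumes "AE w in lborel. R w"
  shows "AE x in lborel. R (hor_end x)"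
proof -
  \<comment> \<open>R need not be measurable; Fubini is applied to a measurable null superset of its
    failure set.\<close>
  obtain N where N: "N \<in> null_sets lborel" "{x. \<not> R x} \<subseteq> N"
    using assms by (auto simp: eventually_ae_filter)
  have N_sets: "N \<in> sets borel" using N(1) by auto
  have "AE x in lborel. AE y in lborel. (x, y) \<notin> N"
    using lborel_pair.AE_pair[OF AE_not_in[OF N(1), folded lborel_prod]] .
  \<comment> \<open>A horizontal jump keeps y and moves the first coordinate, so the quantifier over
    y must be outermost before lifting along \<open>snd\<close>. The vertical case already has the
    right order.\<close>
  then have "AE y in lborel. AE x in lborel. (x, y) \<notin> N"
  proof (subst lborel_pair.AE_commute [symmetric])
    have "{x. x \<notin> N} \<in> sets (lborel \<Otimes>\<^sub>M lborel)"
      using N_sets unfolding lborel_prod by (simp flip: Compl_eq)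
    then show "{x \<in> space (lborel \<Otimes>\<^sub>M lborel). (fst x, snd x) \<notin> N} \<in> sets (lborel \<Otimes>\<^sub>M lborel)"
      by (simp add: space_pair_measure)
  qed
  then have "AE w in (lborel :: ('a \<times> 'b) measure). AE z in lborel. hor_end (w, z) \<notin> N"
    using AE_lborel_snd by (simp add: hor_end_def)
  moreover have "{x \<in> space (lborel \<Otimes>\<^sub>M lborel). hor_end x \<notin> N} \<in> sets (lborel \<Otimes>\<^sub>M lborel)"
    using measurable_sets[OF hor_end_measurable, of "- N"] N_sets
    unfolding lborel_prod by (simp add: vimage_def)
  ultimately have "AE x in lborel \<Otimes>\<^sub>M lborel. hor_end x \<notin> N"
    by (intro lborel_pair.AE_pair_measure)
  then show ?thesis
    unfolding lborel_prod by eventually_elim (use N(2) in auto)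
qed

lemma AE_ver_end:
  fixes R :: "'a::euclidean_space \<times> 'b::euclidean_space \<Rightarrow> bool"
  assumes "AE w in lborel. R w"
  shows "AE x in lborel. R (ver_end x)"
proof -
  obtain N where N: "N \<in> null_sets lborel" "{x. \<not> R x} \<subseteq> N"
    using assms by (auto simp: eventually_ae_filter)
  have N_sets: "N \<in> sets borel" using N(1) by auto
  have "AE x in lborel. AE y in lborel. (x, y) \<notin> N"
    using lborel_pair.AE_pair[OF AE_not_in[OF N(1), folded lborel_prod]] .
  then have "AE w in (lborel :: ('a \<times> 'b) measure). AE z in lborel. ver_end (w, z) \<notin> N"
    using AE_lborel_fst by (simp add: ver_end_def)
  moreover have "{x \<in> space (lborel \<Otimes>\<^sub>M lborel). ver_end x \<notin> N} \<in> sets (lborel \<Otimes>\<^sub>M lborel)"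
    using measurable_sets[OF ver_end_measurable, of "- N"] N_sets
    unfolding lborel_prod by (simp add: vimage_def)
  ultimately have "AE x in lborel \<Otimes>\<^sub>M lborel. ver_end x \<notin> N"
    by (intro lborel_pair.AE_pair_measure)
  then show ?thesis
    unfolding lborel_prod by eventually_elim (use N(2) in auto)
qed

lemma jump_hor:
  "jump (jump_measure (fst :: 'a::euclidean_space \<times> 'b::euclidean_space \<Rightarrow> _) \<kappa>) fst hor_end"
  by unfold_locales
    (simp_all add: borel_measurable_jump hor_end_measurable fst_snd_borel
      AE_jumpI[OF fst_snd_borel(1)] AE_lborel_fst AE_hor_end)

lemma jump_ver:
  "jump (jump_measure (snd :: 'a::euclidean_space \<times> 'b::euclidean_space \<Rightarrow> _) \<kappa>) fst ver_end"
  by unfold_locales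
    (simp_all add: borel_measurable_jump ver_end_measurable fst_snd_borel
      AE_jumpI[OF fst_snd_borel(2)] AE_lborel_fst AE_ver_end)

abbreviation hor_measure ::
  "real \<Rightarrow> real \<Rightarrow> (('a::euclidean_space \<times> 'b::euclidean_space) \<times> 'a) measure" where
  "hor_measure s p \<equiv> jump_measure fst (real DIM('a) + s * p)"

abbreviation ver_measure ::
  "real \<Rightarrow> real \<Rightarrow> (('a::euclidean_space \<times> 'b::euclidean_space) \<times> 'b) measure" where
  "ver_measure s p \<equiv> jump_measure snd (real DIM('b) + s * p)"

abbreviation "hor_energy s p \<equiv> jump.energy (hor_measure s p) fst hor_end p"
abbreviation "ver_energy s p \<equiv> jump.energy (ver_measure s p) fst ver_end p"
abbreviation "hor_form s p \<equiv> jump.form (hor_measure s p) fst hor_end p"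
abbreviation "ver_form s p \<equiv> jump.form (ver_measure s p) fst ver_end p"

lemma aniso_seminorm_eq:
  fixes u :: "'a::euclidean_space \<times> 'b::euclidean_space \<Rightarrow> real"
  assumes [measurable]: "u \<in> borel_measurable borel"
  shows "aniso_seminorm s p u = hor_energy s p u + ver_energy s p u"
  unfolding aniso_seminorm_def jump.energy_def[OF jump_hor] jump.energy_def[OF jump_ver]
  by (subst (1 2) nn_integral_jump) (simp_all add: hor_end_def ver_end_def, measurable)

lemma H_form_eq:
  fixes u v :: "'a::euclidean_space \<times> 'b::euclidean_space \<Rightarrow> real"
  assumes [measurable]: "u \<in> borel_measurable borel" "v \<in> borel_measurable borel"
    and p: "1 < p" and fin: "aniso_seminorm s p u < \<infinity>" "aniso_seminorm s p v < \<infinity>"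
  shows "H_form s p u v = hor_form s p u v + ver_form s p u v"
proof -
  have "hor_energy s p u < \<infinity>" "hor_energy s p v < \<infinity>" "ver_energy s p u < \<infinity>" "ver_energy s p v < \<infinity>"
    using fin by (simp_all add: aniso_seminorm_eq)
  note int = jump.integrable_form[OF jump_hor assms(1,2) p this(1,2)]
    jump.integrable_form[OF jump_ver assms(1,2) p this(3,4)]
  show ?thesis
    unfolding H_form_def jump.form_def[OF jump_hor] jump.form_def[OF jump_ver]
      integral_jump[OF fst_snd_borel(1) int(1)] integral_jump[OF fst_snd_borel(2) int(2)]
    by (simp add: hor_end_def ver_end_def)
qed

subsection \<open>Functions constant along lines\<close>

lemma AE_lborel_open_ex:
  fixes A :: "'c::euclidean_space set"
  assumes "open A" "A \<noteq> {}" "AE x in lborel. x \<in> A \<longrightarrow> P x"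
  shows "\<exists>x\<in>A. P x"
proof (rule ccontr)
  assume *: "\<not> ?thesis"
  have "AE x in lborel. x \<notin> A"
    using assms(3) by eventually_elim (use * in auto)
  then have "A \<in> null_sets lborel"
    using assms(1) by (subst (asm) AE_iff_null_sets [symmetric]) auto
  then have "negligible A"
    by (simp add: negligible_iff_null_sets null_sets_completionI)
  then show False using assms open_not_negligible by blast
qed

text \<open>One good base point (x0, y0) suffices: almost every (z, y) in the box is reached by a
  vertical jump to (x0, y) followed by a horizontal jump to (z, y).\<close>

lemma AE_const_box:
  fixes A :: "'a::euclidean_space set" and B :: "'b::euclidean_space set" and f :: "'a \<times> 'b \<Rightarrow> real"
  assumes "open A" "A \<noteq> {}" "open B" "B \<noteq> {}" and f: "f \<in> borel_measurable borel"
    and hor: "AE w in lborel. AE z in lborel. w \<in> A \<times> B \<and> (z, snd w) \<in> A \<times> B \<longrightarrow> f w = f (z, snd w)"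
    and ver: "AE w in lborel. AE z in lborel. w \<in> A \<times> B \<and> (fst w, z) \<in> A \<times> B \<longrightarrow> f w = f (fst w, z)"
  shows "\<exists>c. AE w in lborel. w \<in> A \<times> B \<longrightarrow> f w = c"
proof -
  have "AE x in lborel. AE y in lborel. AE z in lborel.
      (x \<in> A \<and> y \<in> B) \<and> z \<in> A \<and> y \<in> B \<longrightarrow> f (x, y) = f (z, y)"
    using lborel_pair.AE_pair[OF hor[folded lborel_prod]] by simp
  moreover have "AE x in lborel. AE y in lborel. AE y' in lborel.
      (x \<in> A \<and> y \<in> B) \<and> x \<in> A \<and> y' \<in> B \<longrightarrow> f (x, y) = f (x, y')"
    using lborel_pair.AE_pair[OF ver[folded lborel_prod]] by simp
  ultimately have "AE x in lborel. x \<in> A \<longrightarrow>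
      (AE y in lborel. AE z in lborel.
        (x \<in> A \<and> y \<in> B) \<and> z \<in> A \<and> y \<in> B \<longrightarrow> f (x, y) = f (z, y)) \<and>
      (AE y in lborel. AE y' in lborel.
        (x \<in> A \<and> y \<in> B) \<and> x \<in> A \<and> y' \<in> B \<longrightarrow> f (x, y) = f (x, y'))"
    by eventually_elim (intro impI conjI)
  from AE_lborel_open_ex[OF assms(1,2) this]
  obtain x0 where x0: "x0 \<in> A"
    and 1: "AE y in lborel. AE z in lborel.
        (x0 \<in> A \<and> y \<in> B) \<and> z \<in> A \<and> y \<in> B \<longrightarrow> f (x0, y) = f (z, y)"
    and 3: "AE y in lborel. AE y' in lborel.
        (x0 \<in> A \<and> y \<in> B) \<and> x0 \<in> A \<and> y' \<in> B \<longrightarrow> f (x0, y) = f (x0, y')"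
    by blast
  from 3 have "AE y in lborel. y \<in> B \<longrightarrow>
      (AE y' in lborel. (x0 \<in> A \<and> y \<in> B) \<and> x0 \<in> A \<and> y' \<in> B \<longrightarrow> f (x0, y) = f (x0, y'))"
    by eventually_elim (rule impI)
  from AE_lborel_open_ex[OF assms(3,4) this]
  obtain y0 where 2: "AE y' in lborel. y' \<in> B \<longrightarrow> f (x0, y0) = f (x0, y')"
    using x0 by auto
  \<comment> \<open>Measurability is needed both to exchange the a.e. quantifiers and to return to
    the product measure.\<close>
  have sets: "{w \<in> space (lborel \<Otimes>\<^sub>M lborel). w \<in> A \<times> B \<longrightarrow> f w = f (x0, y0)}
      \<in> sets (lborel \<Otimes>\<^sub>M lborel)"
  proof -
    have "{w. w \<in> A \<times> B \<longrightarrow> f w = f (x0, y0)} = - (A \<times> B) \<union> f -` {f (x0, y0)}" by auto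
    also have "\<dots> \<in> sets borel"
      using measurable_sets[OF f, of "{f (x0, y0)}"] open_Times[OF assms(1,3)]
      by (intro sets.Un) auto
    finally show ?thesis unfolding lborel_prod by simp
  qed
  have "AE y in lborel. AE z in lborel. (z, y) \<in> A \<times> B \<longrightarrow> f (z, y) = f (x0, y0)"
    using 1 2
  proof eventually_elim
    case (elim y)
    from elim(1) show ?case by eventually_elim (use elim(2) x0 in auto)
  qed
  then have "AE z in lborel. AE y in lborel. (z, y) \<in> A \<times> B \<longrightarrow> f (z, y) = f (x0, y0)"
    using lborel_pair.AE_commute[of "\<lambda>z y. (z, y) \<in> A \<times> B \<longrightarrow> f (z, y) = f (x0, y0)"] sets by simp
  then have "AE w in lborel. w \<in> A \<times> B \<longrightarrow> f w = f (x0, y0)"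
    by (rule lborel_pair.AE_pair_measure[OF sets, unfolded lborel_prod])
  then show ?thesis by blast
qed

text \<open>Every point has a box on which f is a.e. constant. Overlapping boxes meet in a nonempty
  open set, which is not null, so their constants agree; the chosen constants thus form a locally
  constant function on a connected set.\<close>

lemma AE_const_connected:
  fixes \<Omega> :: "('a::euclidean_space \<times> 'b::euclidean_space) set" and f :: "'a \<times> 'b \<Rightarrow> real"
  assumes "open \<Omega>" "connected \<Omega>" and f: "f \<in> borel_measurable borel"
    and hor: "AE w in lborel. AE z in lborel. w \<in> \<Omega> \<and> (z, snd w) \<in> \<Omega> \<longrightarrow> f w = f (z, snd w)"
    and ver: "AE w in lborel. AE z in lborel. w \<in> \<Omega> \<and> (fst w, z) \<in> \<Omega> \<longrightarrow> f w = f (fst w, z)"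
  shows "\<exists>c. AE w in lborel. w \<in> \<Omega> \<longrightarrow> f w = c"
proof -
  have "\<exists>S c. open S \<and> q \<in> S \<and> S \<subseteq> \<Omega> \<and> (AE w in lborel. w \<in> S \<longrightarrow> f w = c)" if q: "q \<in> \<Omega>" for q
  proof -
    obtain A B where AB: "open A" "open B" "q \<in> A \<times> B" "A \<times> B \<subseteq> \<Omega>"
      using open_prod_elim[OF assms(1) q] by metis
    have "AE w in lborel. AE z in lborel. w \<in> A \<times> B \<and> (z, snd w) \<in> A \<times> B \<longrightarrow> f w = f (z, snd w)"
      using hor
    proof eventually_elim
      case (elim w)
      then show ?case by eventually_elim (use AB(4) in auto)
    qed
    moreover have "AE w in lborel. AE z in lborel. w \<in> A \<times> B \<and> (fst w, z) \<in> A \<times> B \<longrightarrow> f w = f (fst w, z)"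
      using ver
    proof eventually_elim
      case (elim w)
      then show ?case by eventually_elim (use AB(4) in auto)
    qed
    ultimately have "\<exists>c. AE w in lborel. w \<in> A \<times> B \<longrightarrow> f w = c"
      using AB f by (intro AE_const_box) auto
    then show ?thesis using AB open_Times[OF AB(1,2)] by metis
  qed
  then have "\<forall>q\<in>\<Omega>. \<exists>S c. open S \<and> q \<in> S \<and> S \<subseteq> \<Omega> \<and> (AE w in lborel. w \<in> S \<longrightarrow> f w = c)"
    by (rule ballI)
  from bchoice[OF this] obtain S where "\<forall>q\<in>\<Omega>. \<exists>c. open (S q) \<and> q \<in> S q \<and> S q \<subseteq> \<Omega> \<and>
      (AE w in lborel. w \<in> S q \<longrightarrow> f w = c)" ..
  from bchoice[OF this] obtain c where Sc: "\<forall>q\<in>\<Omega>. open (S q) \<and> q \<in> S q \<and> S q \<subseteq> \<Omega> \<and>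
      (AE w in lborel. w \<in> S q \<longrightarrow> f w = c q)" ..
  then have S: "\<And>q. q \<in> \<Omega> \<Longrightarrow> open (S q)" "\<And>q. q \<in> \<Omega> \<Longrightarrow> q \<in> S q"
      "\<And>q. q \<in> \<Omega> \<Longrightarrow> S q \<subseteq> \<Omega>"
    by (meson, meson, meson)
  have c: "AE w in lborel. w \<in> S q \<longrightarrow> f w = c q" if "q \<in> \<Omega>" for q
    using bspec[OF Sc that] by (elim conjE)
  have loc: "c q = c r" if "q \<in> \<Omega>" "r \<in> S q" for q r
  proof -
    have r: "r \<in> \<Omega>" using that S(3) by blast
    have "AE w in lborel. w \<in> S q \<inter> S r \<longrightarrow> c q = c r"
      using c[OF that(1)] c[OF r] by eventually_elim auto
    moreover have "open (S q \<inter> S r)" "S q \<inter> S r \<noteq> {}" 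
      using S(1)[OF that(1)] S(1)[OF r] S(2)[OF r] that(2) by blast+
    ultimately have "\<exists>w\<in>S q \<inter> S r. c q = c r" by (intro AE_lborel_open_ex)
    then show ?thesis by blast
  qed
  have "c q = c r" if "q \<in> \<Omega>" "r \<in> \<Omega>" for q r
  proof (rule connected_local_const[OF assms(2) that], rule ballI)
    fix a assume a: "a \<in> \<Omega>"
    show "\<forall>\<^sub>F b in at a within \<Omega>. c a = c b"
      unfolding eventually_at_topological
      using S(1)[OF a] S(2)[OF a] loc[OF a] by blast
  qed
  then obtain k where k: "\<And>q. q \<in> \<Omega> \<Longrightarrow> c q = k" by meson
  \<comment> \<open>Each box has its own exceptional null set, so a countable subcover is needed
    before uniting them.\<close>
  obtain F where F: "F \<subseteq> S ` \<Omega>" "countable F" "\<Union>F = \<Union>(S ` \<Omega>)"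
    using Lindelof[of "S ` \<Omega>"] S(1) by (metis imageE)
  have "AE w in lborel. \<forall>T\<in>F. w \<in> T \<longrightarrow> f w = k"
  proof (rule AE_ball_countable'[OF _ F(2)])
    fix T assume "T \<in> F"
    then obtain q where "q \<in> \<Omega>" "T = S q" using F(1) by blast
    then show "AE w in lborel. w \<in> T \<longrightarrow> f w = k"
      using c[of q] k[of q] by simp
  qed
  then have "AE w in lborel. w \<in> \<Omega> \<longrightarrow> f w = k"
  proof eventually_elim
    case (elim w)
    have "w \<in> \<Union>F" if "w \<in> \<Omega>"
      unfolding F(3) using that S(2)[OF that] by (intro UN_I)
    then show ?case using elim by (meson UnionE)
  qed
  then show ?thesis by blast
qed

subsection \<open>Eigenfunctions\<close>

lemma WtildeD:
  assumes "u \<in> Wtilde s p \<Omega>"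
  shows "u \<in> borel_measurable borel" "integrable lborel (\<lambda>z. \<bar>u z\<bar> powr p)"
    "aniso_seminorm s p u < \<infinity>" "AE z in lborel. z \<notin> \<Omega> \<longrightarrow> u z = 0"
    "hor_energy s p u < \<infinity>" "ver_energy s p u < \<infinity>"
  using assms aniso_seminorm_eq[of u s p] by (auto simp: Wtilde_def)

lemma testfun_Wtilde:
  assumes u: "u \<in> Wtilde s p \<Omega>" and v: "v \<in> Wtilde s p \<Omega>" and p: "1 < p"
  shows "(\<lambda>w. testfun p n (u w) (v w)) \<in> Wtilde s p \<Omega>"
proof -
  note u = WtildeD[OF u] and v = WtildeD[OF v]
  have meas: "(\<lambda>w. testfun p n (u w) (v w)) \<in> borel_measurable borel"
    using u(1) v(1) by (rule testfun_measurable)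
  obtain C where C: "0 \<le> C"
    "\<And>a b c d. \<bar>testfun p n a c - testfun p n b d\<bar> \<le> C * (\<bar>a - b\<bar> + \<bar>c - d\<bar>)"
    using testfun_lipschitz[OF p, of n] by blast
  have bound: "\<bar>testfun p n a c\<bar> powr p \<le> C powr p * \<bar>a\<bar> powr p" for a c
  proof -
    \<comment> \<open>Comparison with a = 0 at the same c, where the test function vanishes.\<close>
    have "\<bar>testfun p n a c\<bar> \<le> C * \<bar>a\<bar>" using C(2)[of a c 0 c] by simp
    then have "\<bar>testfun p n a c\<bar> powr p \<le> (C * \<bar>a\<bar>) powr p"
      using p by (intro powr_mono2) auto
    then show ?thesis by (simp add: powr_mult)
  qed
  have "integrable lborel (\<lambda>w. \<bar>testfun p n (u w) (v w)\<bar> powr p)"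
  proof (rule Bochner_Integration.integrable_bound)
    show "integrable lborel (\<lambda>w. C powr p * \<bar>u w\<bar> powr p)" using u(2) by simp
    show "AE w in lborel. norm (\<bar>testfun p n (u w) (v w)\<bar> powr p) \<le> norm (C powr p * \<bar>u w\<bar> powr p)"
      using bound by (intro AE_I2) simp
  qed (use meas in measurable)
  moreover have "aniso_seminorm s p (\<lambda>w. testfun p n (u w) (v w)) < \<infinity>"
    unfolding aniso_seminorm_eq[OF meas]
    using jump.energy_testfun[OF jump_hor u(1) v(1) p u(5) v(5)]
      jump.energy_testfun[OF jump_ver u(1) v(1) p u(6) v(6)] by simp
  moreover have "AE w in lborel. w \<notin> \<Omega> \<longrightarrow> testfun p n (u w) (v w) = 0"
    using u(4) by eventually_elim auto
  ultimately show ?thesis using meas by (simp add: Wtilde_def)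
qed

lemma set_integral_powr_eq:
  assumes u: "u \<in> Wtilde s p \<Omega>"  and \<Omega>: "open \<Omega>"
  shows "(\<integral>z\<in>\<Omega>. \<bar>u z\<bar> powr p \<partial>lborel) = (\<integral>z. \<bar>u z\<bar> powr p \<partial>lborel)"
  unfolding set_lebesgue_integral_def
proof (rule integral_cong_AE)
  have [measurable]: "\<Omega> \<in> sets borel" using \<Omega> by simp
  note [measurable] = WtildeD(1)[OF u]
  show "(\<lambda>z. indicator \<Omega> z *\<^sub>R \<bar>u z\<bar> powr p) \<in> borel_measurable lborel" by measurable
  show "(\<lambda>z. \<bar>u z\<bar> powr p) \<in> borel_measurable lborel" by measurable
  show "AE z in lborel. indicator \<Omega> z *\<^sub>R \<bar>u z\<bar> powr p = \<bar>u z\<bar> powr p"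
    using WtildeD(4)[OF u] by eventually_elim (auto simp: indicator_def)
qed

lemma set_integral_powr_pos:
  assumes u: "u \<in> Wtilde s p \<Omega>" and \<Omega>: "open \<Omega>" and "\<not> (AE z in lborel. u z = 0)"
  shows "0 < (\<integral>z\<in>\<Omega>. \<bar>u z\<bar> powr p \<partial>lborel)"
proof -
  have "(\<integral>z. \<bar>u z\<bar> powr p \<partial>lborel) = 0 \<longleftrightarrow> (AE z in lborel. \<bar>u z\<bar> powr p = 0)"
    using WtildeD(2)[OF u] by (intro integral_nonneg_eq_0_iff_AE) auto
  then have "(\<integral>z. \<bar>u z\<bar> powr p \<partial>lborel) \<noteq> 0" using assms(3) by simp
  moreover have "0 \<le> (\<integral>z. \<bar>u z\<bar> powr p \<partial>lborel)" by simp
  ultimately show ?thesis unfolding set_integral_powr_eq[OF u \<Omega>] by linarith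
qed

text \<open>The eigenfunction is used as its own test function.\<close>

lemma eigenpair_energy:
  assumes "is_eigenpair s p \<Omega> lam u" "1 < p"
  shows "enn2real (aniso_seminorm s p u) = lam * (\<integral>z\<in>\<Omega>. \<bar>u z\<bar> powr p \<partial>lborel)"
proof -
  have u: "u \<in> Wtilde s p \<Omega>" using assms(1) by (simp add: is_eigenpair_def)
  note W = WtildeD[OF u]
  have "enn2real (aniso_seminorm s p u) = enn2real (hor_energy s p u) + enn2real (ver_energy s p u)"
    unfolding aniso_seminorm_eq[OF W(1)] using W(5,6) by (simp add: enn2real_plus)
  also have "\<dots> = H_form s p u u"
    unfolding H_form_eq[OF W(1,1) assms(2) W(3,3)]
    by (simp add: jump.form_self[OF jump_hor W(1)] jump.form_self[OF jump_ver W(1)])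
  also have "\<dots> = lam * (\<integral>z\<in>\<Omega>. \<bar>u z\<bar> powr p \<partial>lborel)"
    using assms(1) u by (simp add: is_eigenpair_def spow_times_self)
  finally show ?thesis .
qed

lemma lambda1_le_eigenvalue:
  assumes "is_eigenpair s p \<Omega> lam v" "1 < p" "open \<Omega>"
  shows "lambda1 s p \<Omega> \<le> lam"
proof -
  have v: "v \<in> Wtilde s p \<Omega>" "\<not> (AE z in lborel. v z = 0)"
    using assms(1) by (simp_all add: is_eigenpair_def)
  have "lam = enn2real (aniso_seminorm s p v) / (\<integral>z\<in>\<Omega>. \<bar>v z\<bar> powr p \<partial>lborel)"
    using eigenpair_energy[OF assms(1,2)] set_integral_powr_pos[OF v(1) assms(3) v(2)] by simp
  \<comment> \<open>The lower bound 0 of the Rayleigh quotients makes the real infimum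
    meaningful.\<close>
  then show ?thesis
    unfolding lambda1_def using v
    by (intro cInf_lower bdd_belowI[of _ 0])
      (auto intro!: divide_nonneg_nonneg simp: set_lebesgue_integral_def)
qed

section \<open>The bound for the total Picone defect and its limit\<close>

context
  fixes \<Omega> :: "('a::euclidean_space \<times> 'b::euclidean_space) set"
    and s p lam :: real and u v :: "'a \<times> 'b \<Rightarrow> real"
  assumes u: "u \<in> Wtilde s p \<Omega>" and v: "is_eigenpair s p \<Omega> lam v"
    and v_nonneg: "AE z in lborel. 0 \<le> v z" and p: "1 < p"
begin

text \<open>The full energy of u replaces that of its truncation, so that n enters only through the
  test integral.\<close>

definition gap :: "nat \<Rightarrow> real" where
  "gap n = enn2real (aniso_seminorm s p u)
     - lam * (\<integral>z\<in>\<Omega>. spow (v z) (p - 1) * testfun p n (u z) (v z) \<partial>lborel)"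

text \<open>The equation determines only the sum of the horizontal and vertical forms. The sum of
  the two defect integrals is at most the gap, since truncation lowers energy, and each is bounded
  separately because the other is nonnegative.\<close>

lemma nn_integral_defect_le_gap:
  "(\<integral>\<^sup>+x. ennreal (jump.defect fst hor_end p u v n x) \<partial>hor_measure s p) \<le> ennreal (gap n)"
  "(\<integral>\<^sup>+x. ennreal (jump.defect fst ver_end p u v n x) \<partial>ver_measure s p) \<le> ennreal (gap n)"
  "0 \<le> gap n"
proof -
  have vW: "v \<in> Wtilde s p \<Omega>" using v by (simp add: is_eigenpair_def)
  note uW = WtildeD[OF u] and W = WtildeD[OF vW]
  let ?\<phi> = "\<lambda>w. testfun p n (u w) (v w)" and ?U = "\<lambda>w. trunc n (u w)"
  note \<phi> = testfun_Wtilde[OF u vW p, of n]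
  define h1 h2 k1 k2 where "h1 = enn2real (hor_energy s p ?U)" and "h2 = hor_form s p v ?\<phi>"
    and "k1 = enn2real (ver_energy s p ?U)" and "k2 = ver_form s p v ?\<phi>"
  note h = jump.nn_integral_defect[OF jump_hor uW(1) W(1) p uW(5) W(5) v_nonneg, of n,
      folded h1_def h2_def]
  note k = jump.nn_integral_defect[OF jump_ver uW(1) W(1) p uW(6) W(6) v_nonneg, of n,
      folded k1_def k2_def]
  have "h1 \<le> enn2real (hor_energy s p u)" "k1 \<le> enn2real (ver_energy s p u)"
    unfolding h1_def k1_def
    using jump.energy_trunc_le[OF jump_hor p] jump.energy_trunc_le[OF jump_ver p] uW(5,6)
    by (auto intro!: enn2real_mono)
  moreover have "enn2real (aniso_seminorm s p u) = enn2real (hor_energy s p u) + enn2real (ver_energy s p u)"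
    unfolding aniso_seminorm_eq[OF uW(1)] using uW(5,6) by (simp add: enn2real_plus)
  moreover have "h2 + k2 = lam * (\<integral>z\<in>\<Omega>. spow (v z) (p - 1) * ?\<phi> z \<partial>lborel)"
    using v \<phi> H_form_eq[OF W(1) WtildeD(1)[OF \<phi>] p W(3) WtildeD(3)[OF \<phi>]]
    by (simp add: is_eigenpair_def h2_def k2_def)
  ultimately have le: "(h1 - h2) + (k1 - k2) \<le> gap n"
    unfolding gap_def by linarith
  show "0 \<le> gap n" using le h(2) k(2) by linarith
  show "(\<integral>\<^sup>+x. ennreal (jump.defect fst hor_end p u v n x) \<partial>hor_measure s p) \<le> ennreal (gap n)"
    unfolding h(1) using le k(2) by (intro ennreal_leI) linarith
  show "(\<integral>\<^sup>+x. ennreal (jump.defect fst ver_end p u v n x) \<partial>ver_measure s p) \<le> ennreal (gap n)"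
    unfolding k(1) using le h(2) by (intro ennreal_leI) linarith
qed

lemma gap_le:
  assumes "0 < lam"
  shows "gap n \<le> enn2real (aniso_seminorm s p u)"
proof -
  have "0 \<le> (\<integral>z\<in>\<Omega>. spow (v z) (p - 1) * testfun p n (u z) (v z) \<partial>lborel)"
    unfolding set_lebesgue_integral_def
    using v_nonneg by (intro integral_nonneg_AE) (auto elim!: eventually_mono simp: spow_def testfun_def)
  then show ?thesis unfolding gap_def using assms by simp
qed

text \<open>Where v > 0 the factor v^(p-1) (v + 1/(n+1))^(1-p) is at most 1 and tends to 1, so |u|^p
  dominates the integrands.\<close>

lemma gap_tendsto:
  assumes \<Omega>: "open \<Omega>" and u_pos: "AE z in lborel. z \<in> \<Omega> \<longrightarrow> 0 < u z"
    and v_pos: "AE z in lborel. z \<in> \<Omega> \<longrightarrow> 0 < v z"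
  shows "gap \<longlonglongrightarrow> enn2real (aniso_seminorm s p u) - lam * (\<integral>z\<in>\<Omega>. \<bar>u z\<bar> powr p \<partial>lborel)"
proof -
  have [measurable]: "\<Omega> \<in> sets borel" using \<Omega> by simp
  have [measurable]: "u \<in> borel_measurable borel" "v \<in> borel_measurable borel"
    using WtildeD(1)[OF u] v by (auto simp: is_eigenpair_def WtildeD(1))
  have lim: "(\<lambda>n. \<integral>z\<in>\<Omega>. spow (v z) (p - 1) * testfun p n (u z) (v z) \<partial>lborel)
      \<longlonglongrightarrow> (\<integral>z\<in>\<Omega>. \<bar>u z\<bar> powr p \<partial>lborel)"
    unfolding set_lebesgue_integral_def
  proof (rule integral_dominated_convergence[where w="\<lambda>z. \<bar>u z\<bar> powr p"])
    show "integrable lborel (\<lambda>z. \<bar>u z\<bar> powr p)" using WtildeD(2)[OF u] .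
    show "AE z in lborel. (\<lambda>n. indicator \<Omega> z *\<^sub>R (spow (v z) (p - 1) * testfun p n (u z) (v z)))
        \<longlonglongrightarrow> indicator \<Omega> z *\<^sub>R \<bar>u z\<bar> powr p"
      using u_pos v_pos
    proof eventually_elim
      case (elim z)
      show ?case
      proof (cases "z \<in> \<Omega>")
        case True
        then have pos: "0 < u z" "0 < v z" using elim by auto
        have "(\<lambda>n. spow (v z) (p - 1) * (u z powr p * (v z + inverse (real (Suc n))) powr (1 - p)))
            \<longlonglongrightarrow> spow (v z) (p - 1) * (u z powr p * v z powr (1 - p))"
          using pos by (intro tendsto_intros tendsto_inverse_Suc) auto
        also have "spow (v z) (p - 1) * (u z powr p * v z powr (1 - p))
            = u z powr p * (v z powr (p - 1) * v z powr (1 - p))"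
          using pos by (simp add: spow_def)
        also have "v z powr (p - 1) * v z powr (1 - p) = 1"
          using pos by (simp flip: powr_add)
        finally have "(\<lambda>n. spow (v z) (p - 1) * (u z powr p * (v z + inverse (real (Suc n))) powr (1 - p)))
            \<longlonglongrightarrow> u z powr p" by simp
        moreover have "\<forall>\<^sub>F n in sequentially.
            spow (v z) (p - 1) * (u z powr p * (v z + inverse (real (Suc n))) powr (1 - p))
            = spow (v z) (p - 1) * testfun p n (u z) (v z)"
          using eventually_min_Suc[of "u z"]
          by eventually_elim (use pos in \<open>simp add: testfun_def trunc_def max_absorb2\<close>)
        ultimately have "(\<lambda>n. spow (v z) (p - 1) * testfun p n (u z) (v z)) \<longlonglongrightarrow> u z powr p"
          by (rule Lim_transform_eventually)
        then show ?thesis using True pos by simp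
      qed simp
    qed
    show "AE z in lborel. norm (indicator \<Omega> z *\<^sub>R (spow (v z) (p - 1) * testfun p n (u z) (v z)))
        \<le> \<bar>u z\<bar> powr p" for n
      using v_pos
    proof eventually_elim
      case (elim z)
      show ?case
      proof (cases "z \<in> \<Omega>")
        case True
        then have pos: "0 < v z" using elim by auto
        have "v z powr (p - 1) * (v z + inverse (real (Suc n))) powr (1 - p)
            \<le> v z powr (p - 1) * v z powr (1 - p)"
          using pos p by (intro mult_left_mono powr_mono2') auto
        also have "\<dots> = 1" using pos by (simp flip: powr_add)
        finally have "trunc n (u z) powr p * (v z powr (p - 1) * (v z + inverse (real (Suc n))) powr (1 - p))
            \<le> \<bar>u z\<bar> powr p * 1"
          using p trunc_bounds by (intro mult_mono powr_mono2) auto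
        then show ?thesis
          using True pos by (simp add: spow_def testfun_def abs_mult max_absorb2 mult_ac)
      qed simp
    qed
  qed (unfold spow_def, measurable)
  show ?thesis
    unfolding gap_def by (intro tendsto_diff tendsto_mult tendsto_const lim)
qed

end

theorem theorem3p7:
  fixes \<Omega> :: "('a::euclidean_space \<times> 'b::euclidean_space) set"
    and s p lam :: real and u v :: "'a \<times> 'b \<Rightarrow> real"
  assumes "bounded \<Omega>" and "lipschitz_domain \<Omega>"
    and "0 < s" "s < 1" "1 < p"
    and "is_eigenpair s p \<Omega> (lambda1 s p \<Omega>) u"
    and "AE z in lborel. z \<in> \<Omega> \<longrightarrow> u z > 0"
    and "lam > 0"
    and "is_eigenpair s p \<Omega> lam v"
    and "AE z in lborel. v z \<ge> 0"
  shows "lam = lambda1 s p \<Omega> \<and> (\<exists>k::real. AE z in lborel. z \<in> \<Omega> \<longrightarrow> v z = k * u z)"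
proof -
  have \<Omega>: "open \<Omega>" "connected \<Omega>"
    using assms(2) by (simp_all add: lipschitz_domain_def)
  note p = assms(5) and u_pos = assms(7) and v_nonneg = assms(10)
  have uW: "u \<in> Wtilde s p \<Omega>" and u0: "\<not> (AE z in lborel. u z = 0)"
    and vW: "v \<in> Wtilde s p \<Omega>" and v0: "\<not> (AE z in lborel. v z = 0)"
    using assms(6,9) by (simp_all add: is_eigenpair_def)
  note u = WtildeD[OF uW] and v = WtildeD[OF vW]
  have [measurable]: "u \<in> borel_measurable borel" "v \<in> borel_measurable borel"
    using u(1) v(1) .
  have u_nonneg: "AE z in lborel. 0 \<le> u z"
    using u(4) u_pos by eventually_elim force
  note gap = nn_integral_defect_le_gap[OF uW assms(9) v_nonneg p]
  note le = order_trans[OF gap(1) ennreal_leI[OF gap_le[OF uW assms(9) v_nonneg p assms(8)]]]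
    order_trans[OF gap(2) ennreal_leI[OF gap_le[OF uW assms(9) v_nonneg p assms(8)]]]

  have v_pos: "AE z in lborel. z \<in> \<Omega> \<longrightarrow> 0 < v z"
  proof -
    \<comment> \<open>The sign of v is encoded as a real function so that constancy along lines can
      be applied to it.\<close>
    let ?f = "\<lambda>z. if 0 < v z then 1 else 0 :: real"
    have "AE x in hor_measure s p. fst x \<in> \<Omega> \<and> hor_end x \<in> \<Omega> \<longrightarrow> ?f (fst x) = ?f (hor_end x)"
      using jump.AE_same_sign[OF jump_hor u(1) v(1) p u_nonneg v_nonneg le(1)]
        jump.AE_P[OF jump_hor u_pos] jump.AE_Q[OF jump_hor u_pos]
      by eventually_elim simp
    from AE_jumpD[OF fst_snd_borel(1) this]
    have hor: "AE w in lborel. AE z in lborel. w \<in> \<Omega> \<and> (z, snd w) \<in> \<Omega> \<longrightarrow> ?f w = ?f (z, snd w)"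
      by (simp add: hor_end_def)
    have "AE x in ver_measure s p. fst x \<in> \<Omega> \<and> ver_end x \<in> \<Omega> \<longrightarrow> ?f (fst x) = ?f (ver_end x)"
      using jump.AE_same_sign[OF jump_ver u(1) v(1) p u_nonneg v_nonneg le(2)]
        jump.AE_P[OF jump_ver u_pos] jump.AE_Q[OF jump_ver u_pos]
      by eventually_elim simp
    from AE_jumpD[OF fst_snd_borel(2) this]
    have ver: "AE w in lborel. AE z in lborel. w \<in> \<Omega> \<and> (fst w, z) \<in> \<Omega> \<longrightarrow> ?f w = ?f (fst w, z)"
      by (simp add: ver_end_def)
    have "?f \<in> borel_measurable borel" by measurable
    from AE_const_connected[OF \<Omega> this hor ver]
    obtain c where c: "AE w in lborel. w \<in> \<Omega> \<longrightarrow> ?f w = c" by blast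
    have "c = 1"
    proof (rule ccontr)
      \<comment> \<open>Then v <= 0 a.e. in \<open>\<Omega>\<close>, and v vanishes outside, so v
        would be trivial.\<close>
      assume "c \<noteq> 1"
      have "AE z in lborel. v z = 0"
        using c v_nonneg v(4) by eventually_elim (use \<open>c \<noteq> 1\<close> in \<open>force split: if_splits\<close>)
      with v0 show False by blast
    qed
    with c show ?thesis by (auto elim!: eventually_mono split: if_splits)
  qed

  define I where "I = (\<integral>z\<in>\<Omega>. \<bar>u z\<bar> powr p \<partial>lborel)"
  have I: "0 < I" unfolding I_def using set_integral_powr_pos[OF uW \<Omega>(1) u0] .
  have lim: "gap \<Omega> s p lam u v \<longlonglongrightarrow> (lambda1 s p \<Omega> - lam) * I"
    using gap_tendsto[OF uW assms(9) v_nonneg p \<Omega>(1) u_pos v_pos]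
    unfolding eigenpair_energy[OF assms(6) p] by (simp add: I_def algebra_simps)
  \<comment> \<open>The gaps are nonnegative, hence so is their limit; as I > 0, this is the
    inequality lam <= lambda_1.\<close>
  have "0 \<le> (lambda1 s p \<Omega> - lam) * I"
    using lim gap(3) by (intro LIMSEQ_le_const) auto
  moreover have "lambda1 s p \<Omega> \<le> lam" using lambda1_le_eigenvalue[OF assms(9) p \<Omega>(1)] .
  ultimately have lam: "lam = lambda1 s p \<Omega>"
    using I by (simp add: zero_le_mult_iff)
  have lim0: "gap \<Omega> s p lam u v \<longlonglongrightarrow> 0" using lim lam by simp

  \<comment> \<open>The default value of the quotient where u = 0 is immaterial, because only points
    of \<open>\<Omega>\<close>, where u > 0 a.e., are compared.\<close>
  let ?f = "\<lambda>z. v z / u z"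
  have ratio: "v x / u x = v y / u y"
    if "u x * v y = u y * v x" "0 < u x" "0 < u y" for x y
    using that by (simp add: field_simps)
  have "AE x in hor_measure s p. fst x \<in> \<Omega> \<and> hor_end x \<in> \<Omega> \<longrightarrow> ?f (fst x) = ?f (hor_end x)"
    using jump.AE_proportional[OF jump_hor u(1) v(1) p u_nonneg gap(1) lim0]
      jump.AE_P[OF jump_hor u_pos] jump.AE_Q[OF jump_hor u_pos]
      jump.AE_P[OF jump_hor v_pos] jump.AE_Q[OF jump_hor v_pos]
    by eventually_elim (use ratio in blast)
  from AE_jumpD[OF fst_snd_borel(1) this]
  have hor: "AE w in lborel. AE z in lborel. w \<in> \<Omega> \<and> (z, snd w) \<in> \<Omega> \<longrightarrow> ?f w = ?f (z, snd w)"
    by (simp add: hor_end_def)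
  have "AE x in ver_measure s p. fst x \<in> \<Omega> \<and> ver_end x \<in> \<Omega> \<longrightarrow> ?f (fst x) = ?f (ver_end x)"
    using jump.AE_proportional[OF jump_ver u(1) v(1) p u_nonneg gap(2) lim0]
      jump.AE_P[OF jump_ver u_pos] jump.AE_Q[OF jump_ver u_pos]
      jump.AE_P[OF jump_ver v_pos] jump.AE_Q[OF jump_ver v_pos]
    by eventually_elim (use ratio in blast)
  from AE_jumpD[OF fst_snd_borel(2) this]
  have ver: "AE w in lborel. AE z in lborel. w \<in> \<Omega> \<and> (fst w, z) \<in> \<Omega> \<longrightarrow> ?f w = ?f (fst w, z)"
    by (simp add: ver_end_def)
  have "?f \<in> borel_measurable borel" by measurable
  from AE_const_connected[OF \<Omega> this hor ver]
  obtain k where "AE w in lborel. w \<in> \<Omega> \<longrightarrow> ?f w = k" by blast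
  then have "AE z in lborel. z \<in> \<Omega> \<longrightarrow> v z = k * u z"
    using u_pos by eventually_elim (auto simp: field_simps)
  with lam show ?thesis by blast
qed

end
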